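(* Let $G$ be a finite perfect group. If $n$ is the length of a Krull-Remak-Schmidt decomposition of $\operatorname{Inn}(G)$ as an $\operatorname{Aut}(G)$-group, then $\mathcal{J}(G)$ has $2^n$ elements, that is, there are $2^n$ regular subgroups $N \trianglelefteq \operatorname{Hol}(G)$.
   Context: A group $G$ is perfect if $G = G'$. $S(G)$ is the group of all permutations of the set $G$, $\rho : G \to S(G)$ is the right regular representation ($x \mapsto xg$), and $\operatorname{Hol}(G) = N_{S(G)}(\rho(G)) = \operatorname{Aut}(G)\rho(G)$ is the holomorph. Define $$\mathcal{J}(G) = \{ N \le S(G) : N \text{ is regular}, N \trianglelefteq \operatorname{Hol}(G) \}.$$ $\operatorname{Inn}(G)$ is regarded as a group with operator group $\operatorname{Aut}(G)$, acting by conjugation. A Krull-Remak-Schmidt decomposition of $\operatorname{Inn}(G)$ as an $\operatorname{Aut}(G)$-group is a decomposition $\operatorname{Inn}(G) = A_1 \times \dots \times A_n$ as an internal direct product of non-trivial $\operatorname{Aut}(G)$-invariant subgroups $A_i$, none of which can be written as the direct product of two non-trivial $\operatorname{Aut}(G)$-invariant subgroups; its length is $n$. *)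

theory Defs
  imports "HOL-Algebra.Algebra"
begin

definition perfect_group :: "('a, 'b) monoid_scheme \<Rightarrow> bool" where
  "perfect_group G \<longleftrightarrow> group G \<and> derived G (carrier G) = carrier G"

text \<open>
  The symmetric group on \<open>carrier G\<close> is \<open>BijGroup (carrier G)\<close>, whose elements are the extensional
  bijections, multiplied by \<open>f \<otimes> g = f \<circ> g\<close>. Permutations acting on the right would instead be
  multiplied by \<open>g \<circ> f\<close>; the two groups are opposite to each other, so they have the same
  subgroups, the same normalizers and the same normal subgroups.
\<close>

definition right_regular :: "('a, 'b) monoid_scheme \<Rightarrow> 'a \<Rightarrow> 'a \<Rightarrow> 'a" where
  "right_regular G g = (\<lambda>x\<in>carrier G. x \<otimes>\<^bsub>G\<^esub> g)"

definition holomorph :: "('a, 'b) monoid_scheme \<Rightarrow> ('a \<Rightarrow> 'a) set" where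
  "holomorph G = normalizer (BijGroup (carrier G)) (right_regular G ` carrier G)"

definition HolGroup :: "('a, 'b) monoid_scheme \<Rightarrow> ('a \<Rightarrow> 'a) monoid" where
  "HolGroup G = BijGroup (carrier G) \<lparr>carrier := holomorph G\<rparr>"

definition regular_subgroup :: "'a set \<Rightarrow> ('a \<Rightarrow> 'a) set \<Rightarrow> bool" where
  "regular_subgroup E N \<longleftrightarrow>
     subgroup N (BijGroup E) \<and>
     transitive_action (BijGroup E \<lparr>carrier := N\<rparr>) E (\<lambda>f. f) \<and>
     (\<forall>x\<in>E. stabilizer (BijGroup E \<lparr>carrier := N\<rparr>) (\<lambda>f. f) x = {\<one>\<^bsub>BijGroup E\<^esub>})"

definition regular_normal_subgroups :: "('a, 'b) monoid_scheme \<Rightarrow> ('a \<Rightarrow> 'a) set set" where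
  "regular_normal_subgroups G = {N. regular_subgroup (carrier G) N \<and> N \<lhd> HolGroup G}"

definition inner_aut :: "('a, 'b) monoid_scheme \<Rightarrow> 'a \<Rightarrow> 'a \<Rightarrow> 'a" where
  "inner_aut G g = (\<lambda>x\<in>carrier G. inv\<^bsub>G\<^esub> g \<otimes>\<^bsub>G\<^esub> x \<otimes>\<^bsub>G\<^esub> g)"

definition InnGroup :: "('a, 'b) monoid_scheme \<Rightarrow> ('a \<Rightarrow> 'a) monoid" where
  "InnGroup G = AutoGroup G \<lparr>carrier := inner_aut G ` carrier G\<rparr>"

definition aut_invariant_subgroup :: "('a, 'b) monoid_scheme \<Rightarrow> ('a \<Rightarrow> 'a) set \<Rightarrow> bool" where
  "aut_invariant_subgroup G A \<longleftrightarrow>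
     subgroup A (InnGroup G) \<and>
     (\<forall>\<alpha>\<in>auto G. \<forall>a\<in>A.
        \<alpha> \<otimes>\<^bsub>AutoGroup G\<^esub> a \<otimes>\<^bsub>AutoGroup G\<^esub> inv\<^bsub>AutoGroup G\<^esub> \<alpha> \<in> A)"

text \<open>The empty list of factors is allowed; its product is the trivial group.\<close>

definition internal_direct_product :: "('a, 'b) monoid_scheme \<Rightarrow> 'a set list \<Rightarrow> bool" where
  "internal_direct_product H As \<longleftrightarrow>
     (\<forall>i<length As. As ! i \<lhd> H) \<and>
     generate H (\<Union>i<length As. As ! i) = carrier H \<and>
     (\<forall>i<length As. As ! i \<inter> generate H (\<Union>j\<in>{..<length As} - {i}. As ! j) = {\<one>\<^bsub>H\<^esub>})"

definition aut_decomposable :: "('a, 'b) monoid_scheme \<Rightarrow> ('a \<Rightarrow> 'a) set \<Rightarrow> bool" where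
  "aut_decomposable G A \<longleftrightarrow>
     (\<exists>B C. aut_invariant_subgroup G B \<and> B \<noteq> {\<one>\<^bsub>InnGroup G\<^esub>} \<and>
            aut_invariant_subgroup G C \<and> C \<noteq> {\<one>\<^bsub>InnGroup G\<^esub>} \<and>
            internal_direct_product (InnGroup G \<lparr>carrier := A\<rparr>) [B, C])"

definition krs_decomposition :: "('a, 'b) monoid_scheme \<Rightarrow> ('a \<Rightarrow> 'a) set list \<Rightarrow> bool" where
  "krs_decomposition G As \<longleftrightarrow>
     internal_direct_product (InnGroup G) As \<and>
     (\<forall>A\<in>set As. aut_invariant_subgroup G A \<and> A \<noteq> {\<one>\<^bsub>InnGroup G\<^esub>} \<and>
                  \<not> aut_decomposable G A)"

end

theory Submission
  imports Defs
begin

text \<open>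
  Let \<open>N\<close> be a regular normal subgroup of the holomorph. The element of \<open>N\<close> sending \<open>1\<close> to \<open>g\<close>
  has the form \<open>x \<mapsto> \<gamma>(g)(x) g\<close> with \<open>\<gamma>(g)\<close> an automorphism, and normality of \<open>N\<close> amounts to
  \<open>\<gamma> : G \<rightarrow> Aut(G)\<close> being a homomorphism with \<open>\<gamma>(\<beta>(g)) = \<beta> \<gamma>(g) \<beta>\<^sup>-\<^sup>1\<close> for all automorphisms \<open>\<beta>\<close>.
  When \<open>G\<close> is perfect, \<open>\<gamma>\<close> takes values in \<open>Inn(G)\<close>, since it does so on commutators. Equivariance
  under inner automorphisms then says that \<open>\<gamma>(k)\<^sup>-\<^sup>1\<close> times conjugation by \<open>k\<close> centralizes the image
  of \<open>\<gamma>\<close>, and as \<open>Inn(G)\<close> is centreless by Gruen's lemma, \<open>\<gamma>\<close> is conjugation followed by the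
  projection to an \<open>Aut(G)\<close>-invariant direct factor of \<open>Inn(G)\<close>. In a centreless group a
  decomposition into indecomposables is unique, and the direct factors are exactly the partial
  products of it.
\<close>

section \<open>Direct factors of centreless groups\<close>

definition centralizer :: "('a, 'b) monoid_scheme \<Rightarrow> 'a set \<Rightarrow> 'a set" where
  "centralizer G T = {x \<in> carrier G. \<forall>y\<in>T. x \<otimes>\<^bsub>G\<^esub> y = y \<otimes>\<^bsub>G\<^esub> x}"

text \<open>Expresses that \<open>A\<close> is a direct factor. In a centreless group the complement
  of a direct factor can only be its centralizer, so the centralizer is named as the complement
  instead of quantifying over one; that the two meet trivially is then derived in
  \<open>splits_off_Int\<close>.\<close>

definition splits_off :: "('a, 'b) monoid_scheme \<Rightarrow> 'a set \<Rightarrow> bool" where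
  "splits_off G A \<longleftrightarrow>
     subgroup A G \<and> (\<forall>h\<in>carrier G. \<exists>a\<in>A. \<exists>c\<in>centralizer G A. h = a \<otimes>\<^bsub>G\<^esub> c)"

section \<open>Centralizers and pairs of factors in an arbitrary group\<close>

lemma centralizer_carrier: "x \<in> centralizer G T \<Longrightarrow> x \<in> carrier G"
  by (simp add: centralizer_def)

lemma centralizer_commutes:
  "x \<in> centralizer G T \<Longrightarrow> y \<in> T \<Longrightarrow> x \<otimes>\<^bsub>G\<^esub> y = y \<otimes>\<^bsub>G\<^esub> x"
  by (simp add: centralizer_def)

lemma subset_double_centralizer:
  assumes "S \<subseteq> carrier G"
  shows "S \<subseteq> centralizer G (centralizer G S)"
  using assms by (auto simp: centralizer_def)

lemma (in group) commutes_mult: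
  assumes "x \<in> carrier G" "y \<in> carrier G" "z \<in> carrier G"
    and "z \<otimes> x = x \<otimes> z" "z \<otimes> y = y \<otimes> z"
  shows "z \<otimes> (x \<otimes> y) = (x \<otimes> y) \<otimes> z"
  using assms by (metis m_assoc m_closed)

lemma (in group) commutes_inv:
  assumes "x \<in> carrier G" "z \<in> carrier G" and "z \<otimes> x = x \<otimes> z"
  shows "z \<otimes> inv x = inv x \<otimes> z"
  using assms by (metis inv_solve_left inv_solve_right inv_closed m_assoc m_closed)

lemma (in group) subgroup_centralizer:
  assumes "T \<subseteq> carrier G"
  shows "subgroup (centralizer G T) G"
proof
  show "centralizer G T \<subseteq> carrier G"
    by (auto simp: centralizer_def)
  show "x \<otimes> y \<in> centralizer G T"
    if "x \<in> centralizer G T" "y \<in> centralizer G T" for x y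
    using that assms unfolding centralizer_def
    by (auto intro!: commutes_mult[symmetric] dest: subsetD)
  show "\<one> \<in> centralizer G T"
    using assms by (auto simp: centralizer_def)
  show "inv x \<in> centralizer G T" if "x \<in> centralizer G T" for x
    using that assms unfolding centralizer_def
    by (auto intro!: commutes_inv[symmetric] dest: subsetD)
qed

lemma (in group) normal_disjoint_commutes:
  assumes "A \<lhd> G" "B \<lhd> G" "A \<inter> B = {\<one>}" and a: "a \<in> A" and b: "b \<in> B"
  shows "a \<otimes> b = b \<otimes> a"
proof -
  interpret A: normal A G by fact
  interpret B: normal B G by fact
  have [simp]: "a \<in> carrier G" "b \<in> carrier G"
    using a b A.subset B.subset by auto
  \<comment> \<open>The commutator of \<open>a\<close> and \<open>b\<close> lies in \<open>B\<close>
    when \<open>a b inv a\<close> is grouped together, and in \<open>A\<close> when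
    \<open>b inv a inv b\<close> is.\<close>
  have "a \<otimes> b \<otimes> inv a \<otimes> inv b \<in> B"
    using a b by (simp add: B.inv_op_closed2)
  moreover have "a \<otimes> (b \<otimes> inv a \<otimes> inv b) \<in> A"
    using a b by (intro A.m_closed A.inv_op_closed2) auto
  ultimately have "a \<otimes> b \<otimes> inv a \<otimes> inv b = \<one>"
    using assms(3) by (auto simp: m_assoc)
  then have "(a \<otimes> b) \<otimes> inv (b \<otimes> a) = \<one>"
    by (simp add: inv_mult_group m_assoc)
  then show ?thesis
    by (metis \<open>a \<in> carrier G\<close> \<open>b \<in> carrier G\<close> inv_closed inv_equality inv_inv m_closed)
qed

lemma (in group) factors_unique:
  assumes "subgroup A G" "subgroup C G" "A \<inter> C = {\<one>}"
    and "a \<in> A" "a' \<in> A" "c \<in> C" "c' \<in> C" and eq: "a \<otimes> c = a' \<otimes> c'"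
  shows "a = a'" "c = c'"
proof -
  interpret A: subgroup A G by fact
  interpret C: subgroup C G by fact
  have [simp]: "a \<in> carrier G" "a' \<in> carrier G" "c \<in> carrier G" "c' \<in> carrier G"
    using assms A.subset C.subset by auto
  have "inv a' \<otimes> a = c' \<otimes> inv c"
    using eq by (metis \<open>a \<in> carrier G\<close> \<open>a' \<in> carrier G\<close> \<open>c \<in> carrier G\<close> \<open>c' \<in> carrier G\<close>
        inv_closed inv_solve_left inv_solve_right m_assoc m_closed)
  moreover have "inv a' \<otimes> a \<in> A" "c' \<otimes> inv c \<in> C"
    using assms by auto
  ultimately have "inv a' \<otimes> a = \<one>"
    using assms(3) by auto
  then show "a = a'"
    by (metis \<open>a \<in> carrier G\<close> \<open>a' \<in> carrier G\<close> inv_closed inv_equality inv_inv)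
  then show "c = c'"
    using eq by simp
qed

text \<open>Produces the exact shape that indecomposability of \<open>A\<close> forbids, from two
  subgroups that are normal in the whole group.\<close>

lemma (in group) internal_direct_product_pairI:
  assumes "subgroup A G" "B \<lhd> G" "C \<lhd> G" "B \<subseteq> A" "C \<subseteq> A" "B \<inter> C = {\<one>}"
    and BC: "\<And>a. a \<in> A \<Longrightarrow> \<exists>b\<in>B. \<exists>c\<in>C. a = b \<otimes> c"
  shows "internal_direct_product (G\<lparr>carrier := A\<rparr>) [B, C]"
proof -
  have sub: "subgroup B G" "subgroup C G"
    using assms by (auto simp: normal_imp_subgroup)
  have un: "(\<Union>i<length [B, C]. [B, C] ! i) = B \<union> C"
    by (auto simp: less_Suc_eq)
  have gen: "generate (G\<lparr>carrier := A\<rparr>) (B \<union> C) = A"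
  proof
    show "generate (G\<lparr>carrier := A\<rparr>) (B \<union> C) \<subseteq> A"
      using generate_consistent[of "B \<union> C" A] generate_subgroup_incl[of "B \<union> C" A] assms by auto
    show "A \<subseteq> generate (G\<lparr>carrier := A\<rparr>) (B \<union> C)"
    proof
      fix a assume "a \<in> A"
      then obtain b c where "b \<in> B" "c \<in> C" "a = b \<otimes>\<^bsub>G\<lparr>carrier := A\<rparr>\<^esub> c"
        using BC by fastforce
      then show "a \<in> generate (G\<lparr>carrier := A\<rparr>) (B \<union> C)"
        by (metis UnI1 UnI2 generate.eng generate.incl)
    qed
  qed
  have gen1: "generate (G\<lparr>carrier := A\<rparr>) K = K" if "subgroup K G" "K \<subseteq> A" for K
    using that assms(1) generate_consistent[of K A] generateI[of K K] by auto
  have "[B, C] ! i \<lhd> G\<lparr>carrier := A\<rparr>" if "i < length [B, C]" for i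
    using that normal_restrict_supergroup[OF assms(1)] assms(2-5) by (auto simp: less_Suc_eq)
  moreover have "[B, C] ! i \<inter> generate (G\<lparr>carrier := A\<rparr>) (\<Union>j\<in>{..<length [B, C]} - {i}. [B, C] ! j)
      = {\<one>\<^bsub>G\<lparr>carrier := A\<rparr>\<^esub>}" if "i < length [B, C]" for i
  proof -
    \<comment> \<open>The index \<open>i\<close> is 0 or 1, so \<open>1 - i\<close> is the other
      one, and by \<open>gen1\<close> the subgroup generated by the other factor is that
      factor.\<close>
    have "{..<length [B, C]} - {i} = {1 - i}"
      using that by (auto simp: less_Suc_eq)
    then show ?thesis
      using that assms(4-6) gen1 sub by (auto simp: less_Suc_eq)
  qed
  ultimately show ?thesis
    unfolding internal_direct_product_def un gen by simp
qed

locale centreless_group = group +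
  assumes centre_trivial: "z \<in> carrier G \<Longrightarrow> (\<And>x. x \<in> carrier G \<Longrightarrow> z \<otimes> x = x \<otimes> z) \<Longrightarrow> z = \<one>"
begin

text \<open>Every group element is a product of an element of \<open>A\<close> and one of its
  centralizer, so an element commuting with both sets is central.\<close>

lemma splits_off_centralizes_trivial:
  assumes "splits_off G A" "z \<in> centralizer G A" "z \<in> centralizer G (centralizer G A)"
  shows "z = \<one>"
proof (rule centre_trivial)
  show "z \<in> carrier G" using assms by (simp add: centralizer_def)
  fix x assume "x \<in> carrier G"
  then obtain a c where "a \<in> A" "c \<in> centralizer G A" "x = a \<otimes> c"
    using assms(1) by (auto simp: splits_off_def)
  then show "z \<otimes> x = x \<otimes> z"
    using assms by (auto simp: splits_off_def subgroup.mem_carrier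
        intro!: commutes_mult elim: centralizer_commutes centralizer_carrier)
qed

lemma splits_off_Int:
  assumes "splits_off G A"
  shows "A \<inter> centralizer G A = {\<one>}"
proof -
  have A: "subgroup A G" using assms by (simp add: splits_off_def)
  then show ?thesis
    using splits_off_centralizes_trivial[OF assms] subset_double_centralizer[of A]
      subgroup.one_closed[OF A] subgroup.one_closed[OF subgroup_centralizer[of A]] subgroup.subset[OF A]
    by blast
qed

text \<open>Write an element of the double centralizer as \<open>a \<otimes> c\<close>. Since
  \<open>a\<close> lies there too, so does \<open>c\<close>, which also centralizes \<open>A\<close>
  and hence is trivial.\<close>

lemma splits_off_double_centralizer:
  assumes "splits_off G A"
  shows "centralizer G (centralizer G A) = A"
proof
  have A: "subgroup A G" "A \<subseteq> carrier G"
    using assms by (auto simp: splits_off_def subgroup.mem_carrier)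
  show AC: "A \<subseteq> centralizer G (centralizer G A)"
    using A subset_double_centralizer by blast
  show "centralizer G (centralizer G A) \<subseteq> A"
  proof
    fix x assume x: "x \<in> centralizer G (centralizer G A)"
    then obtain a c where ac: "a \<in> A" "c \<in> centralizer G A" "x = a \<otimes> c"
      using assms unfolding splits_off_def by (metis centralizer_carrier)
    have [simp]: "a \<in> carrier G" "c \<in> carrier G"
      using ac A by (auto dest: centralizer_carrier)
    interpret CC: subgroup "centralizer G (centralizer G A)" G
      by (intro subgroup_centralizer) (auto dest: centralizer_carrier)
    have "inv a \<otimes> x \<in> centralizer G (centralizer G A)"
      using x ac AC by (auto intro!: CC.m_closed CC.m_inv_closed)
    then have "c \<in> centralizer G (centralizer G A)"
      using ac by (simp add: m_assoc[symmetric])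
    then have "c = \<one>"
      using splits_off_centralizes_trivial[OF assms] ac by blast
    then show "x \<in> A" using ac by simp
  qed
qed

text \<open>Splitting along \<open>A\<close> restricts to every other direct factor
  \<open>M\<close>, which is the source of uniqueness of decompositions in a centreless group. The
  \<open>A\<close>-component \<open>x\<close> of \<open>m\<close> commutes with the centralizer of
  \<open>M\<close>, so it lies in the double centralizer of \<open>M\<close>, that is, in
  \<open>M\<close>.\<close>

lemma splits_off_refine:
  assumes A: "splits_off G A" and M: "splits_off G M" and m: "m \<in> M"
  shows "\<exists>a\<in>M \<inter> A. \<exists>c\<in>M \<inter> centralizer G A. m = a \<otimes> c"
proof -
  have sA: "subgroup A G" and sM: "subgroup M G"
    using A M by (auto simp: splits_off_def)
  have sC: "subgroup (centralizer G A) G"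
    using sA by (intro subgroup_centralizer subgroup.subset)
  have mG: "m \<in> carrier G" using m sM by (simp add: subgroup.mem_carrier)
  obtain x y where xy: "x \<in> A" "y \<in> centralizer G A" "m = x \<otimes> y"
    using A mG by (auto simp: splits_off_def)
  have cxy [simp]: "x \<in> carrier G" "y \<in> carrier G"
    using xy sA by (auto simp: subgroup.mem_carrier dest: centralizer_carrier)
  have "x \<in> centralizer G (centralizer G M)"
    unfolding centralizer_def[of G "centralizer G M"]
  proof (intro CollectI conjI ballI)
    fix b assume b: "b \<in> centralizer G M"
    then have bG: "b \<in> carrier G" by (rule centralizer_carrier)
    obtain u v where uv: "u \<in> A" "v \<in> centralizer G A" "b = u \<otimes> v"
      using A bG by (auto simp: splits_off_def)
    have [simp]: "u \<in> carrier G" "v \<in> carrier G"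
      using uv sA by (auto simp: subgroup.mem_carrier dest: centralizer_carrier)
    have vx: "v \<otimes> x = x \<otimes> v" and yu: "y \<otimes> u = u \<otimes> y"
      using uv xy by (auto intro: centralizer_commutes)
    \<comment> \<open>Both \<open>m \<otimes> b\<close> and \<open>b \<otimes> m\<close> are sorted
      into an \<open>A\<close>-component followed by a component in the centralizer; equality of the
      \<open>A\<close>-components is what is wanted.\<close>
    have "(x \<otimes> u) \<otimes> (y \<otimes> v) = m \<otimes> b"
      using yu xy uv by (metis \<open>u \<in> carrier G\<close> \<open>v \<in> carrier G\<close> cxy m_assoc m_closed)
    also have "\<dots> = b \<otimes> m"
      using b m by (simp add: centralizer_def)
    also have "\<dots> = (u \<otimes> x) \<otimes> (v \<otimes> y)"
      using vx xy uv by (metis \<open>u \<in> carrier G\<close> \<open>v \<in> carrier G\<close> cxy m_assoc m_closed)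
    finally have "x \<otimes> u = u \<otimes> x"
      using factors_unique(1)[OF sA sC splits_off_Int[OF A]] xy uv sA sC
      by (meson subgroup.m_closed)
    then show "x \<otimes> b = b \<otimes> x"
      using vx uv by (simp add: commutes_mult)
  qed simp
  then have xM: "x \<in> M"
    by (simp add: splits_off_double_centralizer[OF M])
  moreover have "y \<in> M"
  proof -
    have "y = inv x \<otimes> m" using xy by (simp add: m_assoc[symmetric])
    then show ?thesis using xM m sM by (simp add: subgroup.m_closed subgroup.m_inv_closed)
  qed
  ultimately show ?thesis using xy by blast
qed

text \<open>The partial product over \<open>I\<close> is written as the centralizer of the remaining factors, so that
  its admissibility only needs closure of \<open>P\<close> under centralizers.\<close>

lemma bij_betw_indecomposable_factors:
  assumes normal: "\<And>A. P A \<Longrightarrow> A \<lhd> G"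
    and inter: "\<And>A B. P A \<Longrightarrow> P B \<Longrightarrow> P (A \<inter> B)"
    and cent: "\<And>S. (\<And>A. A \<in> S \<Longrightarrow> P A) \<Longrightarrow> P (centralizer G (\<Union>S))"
    and prod: "internal_direct_product G As"
    and As: "\<And>A. A \<in> set As \<Longrightarrow> P A" "\<And>A. A \<in> set As \<Longrightarrow> A \<noteq> {\<one>}"
    and indec: "\<And>A B C. A \<in> set As \<Longrightarrow> P B \<Longrightarrow> P C \<Longrightarrow>
      internal_direct_product (G\<lparr>carrier := A\<rparr>) [B, C] \<Longrightarrow> B = {\<one>} \<or> C = {\<one>}"
  shows "bij_betw (\<lambda>I. centralizer G (\<Union>j\<in>{..<length As} - I. As ! j))
    (Pow {..<length As}) {A. P A \<and> splits_off G A}"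
proof -
  define n where "n = length As"
  define K where "K I = centralizer G (\<Union>j\<in>{..<n} - I. As ! j)" for I
  have sub: "subgroup A G" if "P A" for A
    using that normal normal_imp_subgroup by blast
  have PAs: "P (As ! i)" "As ! i \<noteq> {\<one>}" if "i < n" for i
    using that As by (auto simp: n_def)
  have As_carrier: "As ! i \<subseteq> carrier G" if "i < n" for i
    using sub[OF PAs(1)[OF that]] by (rule subgroup.subset)
  have PK: "P (K I)" for I
    unfolding K_def by (rule cent) (auto intro: PAs)
  have PC: "P (centralizer G A)" if "P A" for A
    using cent[of "{A}"] that by simp
  have comm: "a \<otimes> b = b \<otimes> a"
    if "i < n" "j < n" "i \<noteq> j" "a \<in> As ! i" "b \<in> As ! j" for i j a b
  proof (rule normal_disjoint_commutes)
    show ni: "As ! i \<lhd> G" and nj: "As ! j \<lhd> G"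
      using prod that by (auto simp: internal_direct_product_def n_def)
    have "As ! j \<subseteq> (\<Union>k\<in>{..<length As} - {i}. As ! k)"
      using that by (auto simp: n_def)
    then have "As ! j \<subseteq> generate G (\<Union>k\<in>{..<length As} - {i}. As ! k)"
      by (auto intro: generate.incl)
    moreover have "As ! i \<inter> generate G (\<Union>k\<in>{..<length As} - {i}. As ! k) = {\<one>}"
      using prod that by (auto simp: internal_direct_product_def n_def)
    moreover have "\<one> \<in> As ! i \<inter> As ! j"
      using that sub PAs by (simp add: subgroup.one_closed)
    ultimately show "As ! i \<inter> As ! j = {\<one>}" by blast
  qed (use that in auto)
  have all: "carrier G \<subseteq> H" if "subgroup H G" "\<And>i. i < n \<Longrightarrow> As ! i \<subseteq> H" for H
  proof -
    have "generate G (\<Union>i<length As. As ! i) \<subseteq> H"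
      using that by (intro generate_subgroup_incl) (auto simp: n_def)
    then show ?thesis using prod by (simp add: internal_direct_product_def)
  qed
  \<comment> \<open>The factors generate the group, so commuting with each of them already makes an
    element central.\<close>
  have central: "z = \<one>"
    if z: "z \<in> carrier G" and zc: "\<And>i a. i < n \<Longrightarrow> a \<in> As ! i \<Longrightarrow> z \<otimes> a = a \<otimes> z" for z
  proof (rule centre_trivial[OF z])
    have "carrier G \<subseteq> centralizer G {z}"
      using z zc As_carrier
      by (intro all subgroup_centralizer) (fastforce simp: centralizer_def)+
    then show "z \<otimes> x = x \<otimes> z" if "x \<in> carrier G" for x
      using that by (auto simp: centralizer_def)
  qed
  have KI: "As ! i \<subseteq> K I" if "i < n" "i \<in> I" for i I
    using that comm As_carrier by (fastforce simp: K_def centralizer_def)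
  \<comment> \<open>\<open>A\<close> and its centralizer are normal, so their product is a subgroup;
    once it contains every factor it is the whole group.\<close>
  have splitsI: "splits_off G A" if "P A" "\<And>i. i < n \<Longrightarrow> As ! i \<subseteq> A \<or> As ! i \<subseteq> centralizer G A" for A
  proof -
    have sA: "subgroup A G" and nC: "centralizer G A \<lhd> G"
      using that sub PC normal by auto
    have s: "subgroup (A <#> centralizer G A) G"
      by (rule mult_norm_subgroup(1)) (use normal that sA nC normal_imp_subgroup in auto)
    have "a \<in> A <#> centralizer G A" if "a \<in> A" for a
    proof -
      have "a = a \<otimes> \<one>" using that sA by (simp add: subgroup.mem_carrier)
      then show ?thesis
        using that subgroup.one_closed[OF normal_imp_subgroup[OF nC]] unfolding set_mult_def by blast
    qed
    moreover have "c \<in> A <#> centralizer G A" if "c \<in> centralizer G A" for c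
    proof -
      have "c = \<one> \<otimes> c" using centralizer_carrier[OF that] by simp
      then show ?thesis
        using that subgroup.one_closed[OF sA] unfolding set_mult_def by blast
    qed
    ultimately have "carrier G \<subseteq> A <#> centralizer G A"
      using that all[OF s] by (meson subset_iff)
    then show ?thesis
      using sA unfolding splits_off_def set_mult_def by blast
  qed
  have Ksplit: "splits_off G (K I)" if "I \<subseteq> {..<n}" for I
  proof (rule splitsI[OF PK])
    fix i assume "i < n"
    show "As ! i \<subseteq> K I \<or> As ! i \<subseteq> centralizer G (K I)"
    proof (cases "i \<in> I")
      case False
      with \<open>i < n\<close> As_carrier show ?thesis by (auto simp: K_def centralizer_def)
    qed (use \<open>i < n\<close> KI in auto)
  qed
  have Asplit: "splits_off G (As ! i)" if "i < n" for i
  proof (rule splitsI)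
    fix j assume "j < n"
    then show "As ! j \<subseteq> As ! i \<or> As ! j \<subseteq> centralizer G (As ! i)"
      using that comm[of j i] As_carrier by (cases "i = j") (auto simp: centralizer_def)
  qed (use that PAs in auto)
  \<comment> \<open>A factor with index in \<open>I\<close> but not in \<open>J\<close> would lie in
    \<open>K J\<close> and so centralize itself. Being split off, it meets its centralizer
    trivially, which contradicts its being non-trivial.\<close>
  have inj: "I \<subseteq> J" if "I \<subseteq> {..<n}" "K I = K J" for I J
  proof
    fix i assume "i \<in> I"
    show "i \<in> J"
    proof (rule ccontr)
      assume "i \<notin> J"
      have i: "i < n" using that \<open>i \<in> I\<close> by auto
      then have "As ! i \<subseteq> K J" using KI[OF i \<open>i \<in> I\<close>] that by simp
      then have "As ! i \<subseteq> centralizer G (As ! i)"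
        using \<open>i \<notin> J\<close> i by (auto simp: K_def centralizer_def)
      then show False
        using splits_off_Int[OF Asplit[OF i]] PAs(2)[OF i] by auto
    qed
  qed
  \<comment> \<open>Splitting along \<open>A\<close> cuts \<open>As ! i\<close> into its
    intersections with \<open>A\<close> and with the centralizer of \<open>A\<close>. Both satisfy
    \<open>P\<close>, so indecomposability trivializes one of them.\<close>
  have dich: "As ! i \<subseteq> A \<or> As ! i \<subseteq> centralizer G A"
    if A: "P A" "splits_off G A" and i: "i < n" for A i
  proof -
    let ?B = "As ! i \<inter> A" and ?C = "As ! i \<inter> centralizer G A"
    have P: "P ?B" "P ?C" using inter PAs(1)[OF i] A PC by auto
    have int: "?B \<inter> ?C = {\<one>}"
      using splits_off_Int[OF A(2)] sub[OF PAs(1)[OF i]] subgroup.one_closed by fastforce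
    have ref: "\<exists>b\<in>?B. \<exists>c\<in>?C. a = b \<otimes> c" if "a \<in> As ! i" for a
      using splits_off_refine[OF A(2) Asplit[OF i] that] .
    have "internal_direct_product (G\<lparr>carrier := As ! i\<rparr>) [?B, ?C]"
      using ref int P sub[OF PAs(1)[OF i]] by (intro internal_direct_product_pairI normal) auto
    then have "?B = {\<one>} \<or> ?C = {\<one>}"
      using indec[OF nth_mem] P i unfolding n_def by blast
    then show ?thesis
    proof
      assume "?B = {\<one>}"
      then have "As ! i \<subseteq> centralizer G A"
        using ref by (metis IntE centralizer_carrier l_one singletonD subsetI)
      then show ?thesis ..
    next
      assume "?C = {\<one>}"
      then have "As ! i \<subseteq> A"
        using ref sub[OF A(1)] by (metis IntE r_one singletonD subgroup.mem_carrier subsetI)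
      then show ?thesis ..
    qed
  qed
  have surj: "\<exists>I\<subseteq>{..<n}. A = K I" if A: "P A" "splits_off G A" for A
  proof (intro exI conjI)
    \<comment> \<open>By \<open>dich\<close> the only candidate is the set of factors contained in
      \<open>A\<close>.\<close>
    let ?I = "{i. i < n \<and> As ! i \<subseteq> A}"
    have sA: "subgroup A G" using sub A by simp
    show "?I \<subseteq> {..<n}" by auto
    have AK: "A \<subseteq> K ?I"
    proof
      fix a assume a: "a \<in> A"
      have "a \<otimes> x = x \<otimes> a" if "j < n" "\<not> As ! j \<subseteq> A" "x \<in> As ! j" for j x
        using dich[OF A that(1)] that a by (auto simp: centralizer_def)
      then show "a \<in> K ?I"
        using a sA by (auto simp: K_def centralizer_def subgroup.mem_carrier)
    qed
    have "K ?I \<subseteq> A"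
    proof
      fix x assume x: "x \<in> K ?I"
      then obtain a c where ac: "a \<in> A" "c \<in> centralizer G A" "x = a \<otimes> c"
        using A(2) unfolding splits_off_def K_def by (metis centralizer_carrier)
      have car: "a \<in> carrier G" "c \<in> carrier G"
        using ac sA by (auto simp: subgroup.mem_carrier dest: centralizer_carrier)
      have "c = inv a \<otimes> x" using ac car by (simp add: m_assoc[symmetric])
      then have cK: "c \<in> K ?I"
        using AK ac(1) x sub[OF PK] by (metis subgroup.m_closed subgroup.m_inv_closed subsetD)
      \<comment> \<open>\<open>c\<close> commutes with the factors inside \<open>A\<close> because
        it centralizes \<open>A\<close>, and with the remaining ones because it lies in
        \<open>K ?I\<close>.\<close>
      have "c = \<one>"
      proof (rule central[OF car(2)])
        fix i b assume i: "i < n" and b: "b \<in> As ! i"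
        show "c \<otimes> b = b \<otimes> c"
        proof (cases "As ! i \<subseteq> A")
          case True
          then show ?thesis using b ac by (auto simp: centralizer_def)
        next
          case False
          then show ?thesis using b cK i by (auto simp: K_def centralizer_def)
        qed
      qed
      then show "x \<in> A" using ac car by simp
    qed
    then show "A = K ?I" using AK by blast
  qed
  have "inj_on K (Pow {..<n})"
    by (intro inj_onI subset_antisym) (auto dest: inj)
  moreover have "K ` Pow {..<n} = {A. P A \<and> splits_off G A}"
    using PK Ksplit surj by blast
  ultimately show ?thesis
    by (simp add: bij_betw_def K_def[abs_def] n_def)
qed

end

section \<open>Equivariant homomorphisms and direct factors of the inner automorphism group\<close>

text \<open>\<open>inner_aut G h\<close> is conjugation by \<open>inv h\<close> and thus antimultiplicative in \<open>h\<close>; \<open>conj_aut G\<close> is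
  a homomorphism.\<close>

definition conj_aut :: "('a, 'b) monoid_scheme \<Rightarrow> 'a \<Rightarrow> 'a \<Rightarrow> 'a" where
  "conj_aut G h = inner_aut G (inv\<^bsub>G\<^esub> h)"

text \<open>Equivariance is \<open>\<gamma> (\<beta> g) = \<beta> (\<gamma> g) \<beta>^-1\<close>
  with the inverse cleared. Extensionality fixes the values off the carrier, so that distinct
  elements are distinct homomorphisms and the set can be counted.\<close>

definition equivariant_homs :: "('a, 'b) monoid_scheme \<Rightarrow> ('a \<Rightarrow> 'a \<Rightarrow> 'a) set" where
  "equivariant_homs G = {\<gamma> \<in> hom G (AutoGroup G) \<inter> extensional (carrier G).
     \<forall>\<beta>\<in>auto G. \<forall>g\<in>carrier G. \<gamma> (\<beta> g) \<otimes>\<^bsub>AutoGroup G\<^esub> \<beta> = \<beta> \<otimes>\<^bsub>AutoGroup G\<^esub> \<gamma> g}"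

context group
begin

lemma inv_mult_cancel_left: "x \<in> carrier G \<Longrightarrow> y \<in> carrier G \<Longrightarrow> inv x \<otimes> (x \<otimes> y) = y"
  by (simp add: m_assoc[symmetric])

lemma mult_inv_cancel_left: "x \<in> carrier G \<Longrightarrow> y \<in> carrier G \<Longrightarrow> x \<otimes> (inv x \<otimes> y) = y"
  by (simp add: m_assoc[symmetric])

text \<open>Rewrites products to right-nested words with adjacent inverses cancelled; instances for
  other groups serve in the same way.\<close>

lemmas group_normalize = m_assoc inv_mult_group inv_mult_cancel_left mult_inv_cancel_left

interpretation Aut: group "AutoGroup G"
  by (rule AutoGroup)

lemma carrier_AutoGroup [simp]: "carrier (AutoGroup G) = auto G"
  by (simp add: AutoGroup_def)

text \<open>The simplifier turns the carrier of \<open>AutoGroup G\<close> into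
  \<open>auto G\<close>, so the closure rules are kept in that form as well.\<close>

lemmas Aut_closed [simp] =
  Aut.m_closed[simplified] Aut.inv_closed[simplified] Aut.one_closed[simplified]

lemma auto_closed [simp]: "\<alpha> \<in> auto G \<Longrightarrow> x \<in> carrier G \<Longrightarrow> \<alpha> x \<in> carrier G"
  by (auto simp: auto_def intro: hom_in_carrier)

lemma auto_mult: "\<alpha> \<in> auto G \<Longrightarrow> x \<in> carrier G \<Longrightarrow> y \<in> carrier G \<Longrightarrow> \<alpha> (x \<otimes> y) = \<alpha> x \<otimes> \<alpha> y"
  by (simp add: auto_def hom_mult)

lemma auto_group_hom: "\<alpha> \<in> auto G \<Longrightarrow> group_hom G G \<alpha>"
  by (rule group_hom.intro[OF is_group is_group]) (simp add: group_hom_axioms_def auto_def)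

lemma auto_inv: "\<alpha> \<in> auto G \<Longrightarrow> x \<in> carrier G \<Longrightarrow> \<alpha> (inv x) = inv (\<alpha> x)"
  by (rule group_hom.hom_inv[OF auto_group_hom])

lemma auto_one: "\<alpha> \<in> auto G \<Longrightarrow> \<alpha> \<one> = \<one>"
  by (rule group_hom.hom_one[OF auto_group_hom])

lemma AutoGroup_mult_apply:
  "\<alpha> \<in> auto G \<Longrightarrow> \<beta> \<in> auto G \<Longrightarrow> x \<in> carrier G \<Longrightarrow> (\<alpha> \<otimes>\<^bsub>AutoGroup G\<^esub> \<beta>) x = \<alpha> (\<beta> x)"
  by (simp add: AutoGroup_def BijGroup_def auto_def compose_eq)

lemma auto_eqI:
  assumes "\<alpha> \<in> auto G" "\<beta> \<in> auto G" "\<And>x. x \<in> carrier G \<Longrightarrow> \<alpha> x = \<beta> x"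
  shows "\<alpha> = \<beta>"
  using assms by (intro extensionalityI[of _ "carrier G"]) (auto simp: auto_def Bij_def)

lemma conj_aut_apply: "h \<in> carrier G \<Longrightarrow> x \<in> carrier G \<Longrightarrow> conj_aut G h x = h \<otimes> x \<otimes> inv h"
  by (simp add: conj_aut_def inner_aut_def)

lemma conj_aut_auto [simp]:
  assumes [simp]: "h \<in> carrier G"
  shows "conj_aut G h \<in> auto G"
proof -
  have "conj_aut G h \<in> hom G G"
    by (rule homI) (simp_all add: conj_aut_apply group_normalize)
  moreover have "bij_betw (conj_aut G h) (carrier G) (carrier G)"
    by (rule bij_betw_byWitness[where f' = "conj_aut G (inv h)"])
       (auto simp: conj_aut_apply group_normalize)
  moreover have "conj_aut G h \<in> extensional (carrier G)"
    by (simp add: conj_aut_def inner_aut_def)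
  ultimately show ?thesis by (simp add: auto_def Bij_def)
qed

lemma conj_aut_image: "conj_aut G ` carrier G = inner_aut G ` carrier G"
proof -
  have "inner_aut G g = conj_aut G (inv g)" if "g \<in> carrier G" for g
    using that by (simp add: conj_aut_def)
  then have "inner_aut G ` carrier G \<subseteq> conj_aut G ` carrier G"
    using inv_closed by blast
  then show ?thesis
    by (auto simp: conj_aut_def)
qed

lemma conj_aut_hom: "conj_aut G \<in> hom G (AutoGroup G)"
proof (rule homI)
  fix g h assume [simp]: "g \<in> carrier G" "h \<in> carrier G"
  show "conj_aut G (g \<otimes> h) = conj_aut G g \<otimes>\<^bsub>AutoGroup G\<^esub> conj_aut G h"
    by (rule auto_eqI)
       (auto simp: AutoGroup_mult_apply conj_aut_apply group_normalize)
qed simp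

text \<open>Conjugation is itself equivariant. Normality of Inn(G) in Aut(G) and the equivariance of
  the projections below both rest on this.\<close>

lemma auto_conj_aut:
  assumes [simp]: "\<alpha> \<in> auto G" "h \<in> carrier G"
  shows "\<alpha> \<otimes>\<^bsub>AutoGroup G\<^esub> conj_aut G h = conj_aut G (\<alpha> h) \<otimes>\<^bsub>AutoGroup G\<^esub> \<alpha>"
  by (rule auto_eqI)
     (auto simp: AutoGroup_mult_apply conj_aut_apply auto_mult auto_inv)

lemma conj_aut_mult:
  "g \<in> carrier G \<Longrightarrow> h \<in> carrier G \<Longrightarrow>
    conj_aut G (g \<otimes> h) = conj_aut G g \<otimes>\<^bsub>AutoGroup G\<^esub> conj_aut G h"
  by (rule hom_mult[OF conj_aut_hom])

lemma conj_aut_group_hom: "group_hom G (AutoGroup G) (conj_aut G)"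
  by (rule group_hom.intro[OF is_group AutoGroup]) (simp add: group_hom_axioms_def conj_aut_hom)

section \<open>The inner automorphism group and its invariant subgroups\<close>

lemma carrier_InnGroup: "carrier (InnGroup G) = conj_aut G ` carrier G"
  by (simp add: InnGroup_def conj_aut_image)

lemma InnGroup_mult [simp]: "a \<otimes>\<^bsub>InnGroup G\<^esub> b = a \<otimes>\<^bsub>AutoGroup G\<^esub> b"
  and InnGroup_one [simp]: "\<one>\<^bsub>InnGroup G\<^esub> = \<one>\<^bsub>AutoGroup G\<^esub>"
  by (simp_all add: InnGroup_def)

lemma subgroup_InnGroup: "subgroup (carrier (InnGroup G)) (AutoGroup G)"
  unfolding carrier_InnGroup by (rule group_hom.img_is_subgroup[OF conj_aut_group_hom])

text \<open>Gives the shape expected by results on subgroups of \<open>AutoGroup G\<close>. It is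
  applied by single substitution, since \<open>InnGroup G\<close> reappears on the right.\<close>

lemma InnGroup_eq: "InnGroup G = AutoGroup G\<lparr>carrier := carrier (InnGroup G)\<rparr>"
  by (simp add: InnGroup_def)

lemma group_InnGroup: "group (InnGroup G)"
  by (subst InnGroup_eq, rule Aut.subgroup_imp_group[OF subgroup_InnGroup])

lemma InnGroup_auto: "a \<in> carrier (InnGroup G) \<Longrightarrow> a \<in> auto G"
  by (auto simp: carrier_InnGroup)

lemma conj_aut_InnGroup [simp]: "h \<in> carrier G \<Longrightarrow> conj_aut G h \<in> carrier (InnGroup G)"
  by (simp add: carrier_InnGroup)

lemma InnGroup_inv: "a \<in> carrier (InnGroup G) \<Longrightarrow> inv\<^bsub>InnGroup G\<^esub> a = inv\<^bsub>AutoGroup G\<^esub> a"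
  by (subst InnGroup_eq) (rule Aut.m_inv_consistent[OF subgroup_InnGroup])

lemma InnGroup_closed:
  "a \<in> carrier (InnGroup G) \<Longrightarrow> b \<in> carrier (InnGroup G) \<Longrightarrow>
    a \<otimes>\<^bsub>AutoGroup G\<^esub> b \<in> carrier (InnGroup G)"
  "a \<in> carrier (InnGroup G) \<Longrightarrow> inv\<^bsub>AutoGroup G\<^esub> a \<in> carrier (InnGroup G)"
  using subgroup_InnGroup by (auto intro: subgroup.m_closed subgroup.m_inv_closed)

lemma InnGroup_auto_conj:
  assumes "\<alpha> \<in> auto G" "a \<in> carrier (InnGroup G)"
  shows "\<alpha> \<otimes>\<^bsub>AutoGroup G\<^esub> a \<otimes>\<^bsub>AutoGroup G\<^esub> inv\<^bsub>AutoGroup G\<^esub> \<alpha> \<in> carrier (InnGroup G)"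
  using assms by (auto simp: carrier_InnGroup auto_conj_aut Aut.m_assoc)

lemma centralizer_InnGroup_aut_invariant:
  assumes inv: "\<And>\<alpha> a. \<alpha> \<in> auto G \<Longrightarrow> a \<in> S \<Longrightarrow>
      \<alpha> \<otimes>\<^bsub>AutoGroup G\<^esub> a \<otimes>\<^bsub>AutoGroup G\<^esub> inv\<^bsub>AutoGroup G\<^esub> \<alpha> \<in> S"
    and S: "S \<subseteq> carrier (InnGroup G)"
  shows "aut_invariant_subgroup G (centralizer (InnGroup G) S)"
  unfolding aut_invariant_subgroup_def
proof (intro conjI ballI)
  show "subgroup (centralizer (InnGroup G) S) (InnGroup G)"
    by (rule group.subgroup_centralizer[OF group_InnGroup S])
  fix \<alpha> x assume \<alpha> [simp]: "\<alpha> \<in> auto G" and x: "x \<in> centralizer (InnGroup G) S"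
  have xI: "x \<in> carrier (InnGroup G)" using x by (rule centralizer_carrier)
  then have [simp]: "x \<in> auto G" by (rule InnGroup_auto)
  let ?x = "\<alpha> \<otimes>\<^bsub>AutoGroup G\<^esub> x \<otimes>\<^bsub>AutoGroup G\<^esub> inv\<^bsub>AutoGroup G\<^esub> \<alpha>"
  have "?x \<otimes>\<^bsub>AutoGroup G\<^esub> a = a \<otimes>\<^bsub>AutoGroup G\<^esub> ?x" if a: "a \<in> S" for a
  proof -
    have [simp]: "a \<in> auto G" using a S InnGroup_auto by auto
    \<comment> \<open>The conjugate of \<open>a\<close> by the inverse of \<alpha>; it stays in
      \<open>S\<close>, and conjugating \<open>x b = b x\<close> back by \<alpha> gives the
      claim.\<close>
    define b where "b = inv\<^bsub>AutoGroup G\<^esub> \<alpha> \<otimes>\<^bsub>AutoGroup G\<^esub> a \<otimes>\<^bsub>AutoGroup G\<^esub> \<alpha>"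
    have [simp]: "b \<in> auto G" by (simp add: b_def)
    have "b \<in> S"
      using inv[of "inv\<^bsub>AutoGroup G\<^esub> \<alpha>" a] a by (simp add: b_def)
    then have xb: "x \<otimes>\<^bsub>AutoGroup G\<^esub> b = b \<otimes>\<^bsub>AutoGroup G\<^esub> x"
      using centralizer_commutes[OF x] by simp
    have "?x \<otimes>\<^bsub>AutoGroup G\<^esub> a
        = \<alpha> \<otimes>\<^bsub>AutoGroup G\<^esub> (x \<otimes>\<^bsub>AutoGroup G\<^esub> b) \<otimes>\<^bsub>AutoGroup G\<^esub> inv\<^bsub>AutoGroup G\<^esub> \<alpha>"
      by (simp add: b_def Aut.group_normalize)
    also have "\<dots> = a \<otimes>\<^bsub>AutoGroup G\<^esub> ?x"
      unfolding xb by (simp add: b_def Aut.group_normalize)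
    finally show ?thesis .
  qed
  then show "?x \<in> centralizer (InnGroup G) S"
    using InnGroup_auto_conj[OF \<alpha> xI] by (simp add: centralizer_def)
qed

text \<open>Inner automorphisms are among the automorphisms, so invariance includes
  normality.\<close>

lemma aut_invariant_normal:
  assumes "aut_invariant_subgroup G A"
  shows "A \<lhd> InnGroup G"
  using assms unfolding aut_invariant_subgroup_def
  by (simp add: group.normal_inv_iff[OF group_InnGroup] InnGroup_inv InnGroup_auto)

lemma aut_invariant_inter:
  assumes "aut_invariant_subgroup G A" "aut_invariant_subgroup G B"
  shows "aut_invariant_subgroup G (A \<inter> B)"
  using assms unfolding aut_invariant_subgroup_def
  by (auto intro: group.subgroups_Inter_pair[OF group_InnGroup])

lemma aut_invariant_centralizer:
  assumes "\<And>A. A \<in> \<A> \<Longrightarrow> aut_invariant_subgroup G A"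
  shows "aut_invariant_subgroup G (centralizer (InnGroup G) (\<Union>\<A>))"
proof (rule centralizer_InnGroup_aut_invariant)
  show "\<Union>\<A> \<subseteq> carrier (InnGroup G)"
    using assms by (auto simp: aut_invariant_subgroup_def dest: subgroup.mem_carrier)
qed (use assms in \<open>auto simp: aut_invariant_subgroup_def\<close>)

text \<open>The first form involves \<open>k\<close> only through conjugation by \<open>k\<close>,
  the second involves \<open>l\<close> only through conjugation by \<open>l\<close>. Hence a
  commutator does not change when its entries are altered by central elements.\<close>

lemma commutator_eq_conj:
  assumes "k \<in> carrier G" "l \<in> carrier G"
  shows "k \<otimes> l \<otimes> inv k \<otimes> inv l = conj_aut G k l \<otimes> inv l"
    "k \<otimes> l \<otimes> inv k \<otimes> inv l = k \<otimes> inv (conj_aut G l k)"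
  using assms by (simp_all add: conj_aut_apply group_normalize)

lemma perfect_subset:
  assumes "perfect_group G" "subgroup H G"
    and comm: "\<And>k l. k \<in> carrier G \<Longrightarrow> l \<in> carrier G \<Longrightarrow> k \<otimes> l \<otimes> inv k \<otimes> inv l \<in> H"
  shows "carrier G \<subseteq> H"
proof -
  have "derived G (carrier G) \<subseteq> H"
    unfolding derived_def using assms(2) comm by (intro generate_subgroup_incl) auto
  then show ?thesis using assms(1) by (simp add: perfect_group_def)
qed

text \<open>An element \<open>h\<close> of the second centre acts on \<open>G\<close> by
  \<open>k \<mapsto> [h, k] k\<close> with \<open>[h, k]\<close> central, hence fixes every commutator.\<close>

lemma centreless_InnGroup:
  assumes perfect: "perfect_group G"
  shows "centreless_group (InnGroup G)"
proof (intro centreless_group.intro group_InnGroup centreless_group_axioms.intro)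
  fix z assume z: "z \<in> carrier (InnGroup G)"
    and comm: "\<And>x. x \<in> carrier (InnGroup G) \<Longrightarrow> z \<otimes>\<^bsub>InnGroup G\<^esub> x = x \<otimes>\<^bsub>InnGroup G\<^esub> z"
  have [simp]: "z \<in> auto G" using z by (rule InnGroup_auto)
  have zconj: "conj_aut G (z k) = conj_aut G k" if [simp]: "k \<in> carrier G" for k
  proof -
    \<comment> \<open>Moving \<open>z\<close> past \<open>conj_aut G k\<close> turns it into
      \<open>conj_aut G (z k)\<close>, whereas by assumption the two commute.\<close>
    have "conj_aut G (z k) \<otimes>\<^bsub>AutoGroup G\<^esub> z = conj_aut G k \<otimes>\<^bsub>AutoGroup G\<^esub> z"
      using comm[of "conj_aut G k"] by (simp add: auto_conj_aut[symmetric])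
    then show ?thesis by simp
  qed
  let ?F = "{k \<in> carrier G. z k = k}"
  have "subgroup ?F G"
    by (rule subgroupI) (auto simp: auto_mult auto_inv auto_one intro: exI[of _ \<one>])
  then have "carrier G \<subseteq> ?F"
  proof (rule perfect_subset[OF perfect])
    fix k l assume [simp]: "k \<in> carrier G" "l \<in> carrier G"
    have "z (k \<otimes> l \<otimes> inv k \<otimes> inv l) = z k \<otimes> z l \<otimes> inv (z k) \<otimes> inv (z l)"
      by (simp add: auto_mult auto_inv)
    \<comment> \<open>The first form of the commutator replaces \<open>z k\<close> by
      \<open>k\<close>; rereading the result in the second form then replaces \<open>z l\<close> by
      \<open>l\<close>.\<close>
    also have "\<dots> = conj_aut G k (z l) \<otimes> inv (z l)"
      by (simp add: commutator_eq_conj(1) zconj)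
    also have "\<dots> = k \<otimes> inv (conj_aut G l k)"
      by (simp add: commutator_eq_conj[symmetric]) (simp add: commutator_eq_conj(2) zconj)
    finally show "k \<otimes> l \<otimes> inv k \<otimes> inv l \<in> ?F"
      by (simp add: commutator_eq_conj(2))
  qed
  then have "z = \<one>\<^bsub>AutoGroup G\<^esub>"
    by (intro auto_eqI) (auto simp: AutoGroup_def BijGroup_def id_in_auto)
  then show "z = \<one>\<^bsub>InnGroup G\<^esub>" by simp
qed

section \<open>Equivariant homomorphisms into the automorphism group\<close>

lemma equivariant_homs_hom: "\<gamma> \<in> equivariant_homs G \<Longrightarrow> \<gamma> \<in> hom G (AutoGroup G)"
  by (simp add: equivariant_homs_def)

lemma equivariant_homs_auto: "\<gamma> \<in> equivariant_homs G \<Longrightarrow> g \<in> carrier G \<Longrightarrow> \<gamma> g \<in> auto G"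
  using hom_in_carrier[OF equivariant_homs_hom] by simp

lemma equivariant_homs_mult: "\<gamma> \<in> equivariant_homs G \<Longrightarrow> g \<in> carrier G \<Longrightarrow> h \<in> carrier G \<Longrightarrow>
    \<gamma> (g \<otimes> h) = \<gamma> g \<otimes>\<^bsub>AutoGroup G\<^esub> \<gamma> h"
  by (rule hom_mult[OF equivariant_homs_hom])

lemma equivariant_homs_group_hom: "\<gamma> \<in> equivariant_homs G \<Longrightarrow> group_hom G (AutoGroup G) \<gamma>"
  by (rule group_hom.intro[OF is_group AutoGroup]) (simp add: group_hom_axioms_def equivariant_homs_hom)

lemma equivariant_homs_inv: "\<gamma> \<in> equivariant_homs G \<Longrightarrow> g \<in> carrier G \<Longrightarrow>
    \<gamma> (inv g) = inv\<^bsub>AutoGroup G\<^esub> \<gamma> g"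
  by (rule group_hom.hom_inv[OF equivariant_homs_group_hom])

lemma equivariant_homs_equivariant:
  "\<gamma> \<in> equivariant_homs G \<Longrightarrow> \<beta> \<in> auto G \<Longrightarrow> g \<in> carrier G \<Longrightarrow>
    \<gamma> (\<beta> g) \<otimes>\<^bsub>AutoGroup G\<^esub> \<beta> = \<beta> \<otimes>\<^bsub>AutoGroup G\<^esub> \<gamma> g"
  by (simp add: equivariant_homs_def)

text \<open>By equivariance under conjugation by \<open>k\<close>, \<gamma> sends the commutator of
  \<open>k\<close> and \<open>l\<close> to the commutator of \<open>conj_aut G k\<close> and
  \<open>\<gamma> l\<close>. This is inner, as Inn(G) is normal in Aut(G), and commutators generate
  a perfect group.\<close>

lemma equivariant_homs_Inn:
  assumes perfect: "perfect_group G" and \<gamma>: "\<gamma> \<in> equivariant_homs G" and "g \<in> carrier G"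
  shows "\<gamma> g \<in> carrier (InnGroup G)"
proof -
  note [simp] = equivariant_homs_auto[OF \<gamma>] equivariant_homs_mult[OF \<gamma>] equivariant_homs_inv[OF \<gamma>]
  let ?F = "{k \<in> carrier G. \<gamma> k \<in> carrier (InnGroup G)}"
  have "subgroup ?F G"
    using group_hom.hom_one[OF equivariant_homs_group_hom[OF \<gamma>]] subgroup.one_closed[OF subgroup_InnGroup]
    by (intro subgroupI) (auto simp: InnGroup_closed intro: exI[of _ \<one>])
  then have "carrier G \<subseteq> ?F"
  proof (rule perfect_subset[OF perfect])
    fix k l assume [simp]: "k \<in> carrier G" "l \<in> carrier G"
    have "\<gamma> (conj_aut G k l) \<otimes>\<^bsub>AutoGroup G\<^esub> conj_aut G k = conj_aut G k \<otimes>\<^bsub>AutoGroup G\<^esub> \<gamma> l"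
      by (rule equivariant_homs_equivariant[OF \<gamma>]) simp_all
    then have "\<gamma> (conj_aut G k l)
        = conj_aut G k \<otimes>\<^bsub>AutoGroup G\<^esub> \<gamma> l \<otimes>\<^bsub>AutoGroup G\<^esub> inv\<^bsub>AutoGroup G\<^esub> conj_aut G k"
      by (simp add: Aut.inv_solve_right)
    then have "\<gamma> (k \<otimes> l \<otimes> inv k \<otimes> inv l) = conj_aut G k \<otimes>\<^bsub>AutoGroup G\<^esub>
        (\<gamma> l \<otimes>\<^bsub>AutoGroup G\<^esub> inv\<^bsub>AutoGroup G\<^esub> conj_aut G k \<otimes>\<^bsub>AutoGroup G\<^esub> inv\<^bsub>AutoGroup G\<^esub> \<gamma> l)"
      by (simp add: commutator_eq_conj(1) Aut.m_assoc)
    then show "k \<otimes> l \<otimes> inv k \<otimes> inv l \<in> ?F"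
      by (simp add: InnGroup_auto_conj InnGroup_closed)
  qed
  then show ?thesis using assms by auto
qed

text \<open>The value of \<gamma> at \<open>k g k^-1\<close> is the conjugate of
  \<open>\<gamma> g\<close> by \<open>conj_aut G k\<close>, by equivariance, and by
  \<open>\<gamma> k\<close>, by multiplicativity. The two conjugating elements therefore differ by
  something commuting with \<open>\<gamma> g\<close>.\<close>

lemma equivariant_homs_split:
  assumes perfect: "perfect_group G" and \<gamma>: "\<gamma> \<in> equivariant_homs G" and [simp]: "k \<in> carrier G"
  shows "inv\<^bsub>AutoGroup G\<^esub> \<gamma> k \<otimes>\<^bsub>AutoGroup G\<^esub> conj_aut G k \<in> centralizer (InnGroup G) (\<gamma> ` carrier G)"
proof -
  note [simp] = equivariant_homs_auto[OF \<gamma>]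
  have "(inv\<^bsub>AutoGroup G\<^esub> \<gamma> k \<otimes>\<^bsub>AutoGroup G\<^esub> conj_aut G k) \<otimes>\<^bsub>AutoGroup G\<^esub> \<gamma> g
      = \<gamma> g \<otimes>\<^bsub>AutoGroup G\<^esub> (inv\<^bsub>AutoGroup G\<^esub> \<gamma> k \<otimes>\<^bsub>AutoGroup G\<^esub> conj_aut G k)"
    if [simp]: "g \<in> carrier G" for g
  proof -
    have "conj_aut G k \<otimes>\<^bsub>AutoGroup G\<^esub> \<gamma> g = \<gamma> (conj_aut G k g) \<otimes>\<^bsub>AutoGroup G\<^esub> conj_aut G k"
      using equivariant_homs_equivariant[OF \<gamma>, of "conj_aut G k" g] by simp
    also have "\<gamma> (conj_aut G k g)
        = \<gamma> k \<otimes>\<^bsub>AutoGroup G\<^esub> \<gamma> g \<otimes>\<^bsub>AutoGroup G\<^esub> inv\<^bsub>AutoGroup G\<^esub> \<gamma> k"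
      by (simp add: conj_aut_apply equivariant_homs_mult[OF \<gamma>] equivariant_homs_inv[OF \<gamma>])
    finally show ?thesis by (simp add: Aut.group_normalize)
  qed
  moreover have "inv\<^bsub>AutoGroup G\<^esub> \<gamma> k \<otimes>\<^bsub>AutoGroup G\<^esub> conj_aut G k \<in> carrier (InnGroup G)"
    by (simp add: InnGroup_closed equivariant_homs_Inn[OF perfect \<gamma>])
  ultimately show ?thesis by (auto simp: centralizer_def)
qed

lemma equivariant_homs_image:
  assumes perfect: "perfect_group G" and \<gamma>: "\<gamma> \<in> equivariant_homs G"
  shows "aut_invariant_subgroup G (\<gamma> ` carrier G)" "splits_off (InnGroup G) (\<gamma> ` carrier G)"
proof -
  note [simp] = equivariant_homs_auto[OF \<gamma>]
  have "subgroup (\<gamma> ` carrier G) (AutoGroup G)"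
    by (rule group_hom.img_is_subgroup[OF equivariant_homs_group_hom[OF \<gamma>]])
  then have sub: "subgroup (\<gamma> ` carrier G) (InnGroup G)"
    using Aut.subgroup_incl[OF _ subgroup_InnGroup] equivariant_homs_Inn[OF perfect \<gamma>]
    by (subst InnGroup_eq) auto
  have "\<alpha> \<otimes>\<^bsub>AutoGroup G\<^esub> \<gamma> g \<otimes>\<^bsub>AutoGroup G\<^esub> inv\<^bsub>AutoGroup G\<^esub> \<alpha> = \<gamma> (\<alpha> g)"
    if [simp]: "\<alpha> \<in> auto G" "g \<in> carrier G" for \<alpha> g
    by (simp add: equivariant_homs_equivariant[OF \<gamma>, symmetric] Aut.m_assoc)
  with sub show "aut_invariant_subgroup G (\<gamma> ` carrier G)"
    by (auto simp: aut_invariant_subgroup_def)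
  have "\<exists>a\<in>\<gamma> ` carrier G. \<exists>c\<in>centralizer (InnGroup G) (\<gamma> ` carrier G).
      conj_aut G k = a \<otimes>\<^bsub>InnGroup G\<^esub> c" if [simp]: "k \<in> carrier G" for k
  proof (intro bexI)
    \<comment> \<open>The component in the image is \<open>\<gamma> k\<close>; the cofactor
      centralizes the image by \<open>equivariant_homs_split\<close>.\<close>
    show "conj_aut G k = \<gamma> k \<otimes>\<^bsub>InnGroup G\<^esub> (inv\<^bsub>AutoGroup G\<^esub> \<gamma> k \<otimes>\<^bsub>AutoGroup G\<^esub> conj_aut G k)"
      by (simp add: Aut.mult_inv_cancel_left)
  qed (simp_all add: equivariant_homs_split[OF perfect \<gamma>])
  with sub show "splits_off (InnGroup G) (\<gamma> ` carrier G)"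
    unfolding splits_off_def by (auto simp: carrier_InnGroup)
qed

text \<open>\<open>\<gamma> k\<close> is the component of \<open>conj_aut G k\<close> in the image
  of \<gamma>. Components are unique, so the image determines \<gamma>.\<close>

lemma inj_on_equivariant_homs_image:
  assumes perfect: "perfect_group G"
  shows "inj_on (\<lambda>\<gamma>. \<gamma> ` carrier G) (equivariant_homs G)"
proof (rule inj_onI)
  interpret Inn: centreless_group "InnGroup G" by (rule centreless_InnGroup[OF perfect])
  fix \<gamma> \<delta> assume \<gamma>: "\<gamma> \<in> equivariant_homs G" and \<delta>: "\<delta> \<in> equivariant_homs G"
    and eq: "\<gamma> ` carrier G = \<delta> ` carrier G"
  let ?A = "\<gamma> ` carrier G"
  note [simp] = equivariant_homs_auto[OF \<gamma>] equivariant_homs_auto[OF \<delta>]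
  have s: "subgroup ?A (InnGroup G)"
    using equivariant_homs_image[OF perfect \<gamma>] by (simp add: splits_off_def)
  have "\<gamma> k = \<delta> k" if [simp]: "k \<in> carrier G" for k
  proof (rule Inn.factors_unique(1)[OF s])
    show "subgroup (centralizer (InnGroup G) ?A) (InnGroup G)"
      using s by (intro Inn.subgroup_centralizer subgroup.subset)
    show "?A \<inter> centralizer (InnGroup G) ?A = {\<one>\<^bsub>InnGroup G\<^esub>}"
      by (rule Inn.splits_off_Int[OF equivariant_homs_image(2)[OF perfect \<gamma>]])
    show "\<delta> k \<in> ?A" using eq by simp
    show "inv\<^bsub>AutoGroup G\<^esub> \<gamma> k \<otimes>\<^bsub>AutoGroup G\<^esub> conj_aut G k \<in> centralizer (InnGroup G) ?A"
      by (simp add: equivariant_homs_split[OF perfect \<gamma>])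
    show "inv\<^bsub>AutoGroup G\<^esub> \<delta> k \<otimes>\<^bsub>AutoGroup G\<^esub> conj_aut G k \<in> centralizer (InnGroup G) ?A"
      using eq by (simp add: equivariant_homs_split[OF perfect \<delta>])
  qed (simp_all add: Aut.mult_inv_cancel_left)
  then show "\<gamma> = \<delta>"
    using \<gamma> \<delta> by (auto simp: equivariant_homs_def intro: extensionalityI)
qed

text \<open>The witness is conjugation followed by the projection to \<open>A\<close> along its
  centralizer. Each property follows by exhibiting a decomposition and appealing to uniqueness of
  components (\<open>\<gamma>_eq\<close>).\<close>

lemma equivariant_homs_projection:
  assumes perfect: "perfect_group G"
    and A: "aut_invariant_subgroup G A" "splits_off (InnGroup G) A"
  shows "\<exists>\<gamma>\<in>equivariant_homs G. \<gamma> ` carrier G = A"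
proof -
  interpret Inn: centreless_group "InnGroup G" by (rule centreless_InnGroup[OF perfect])
  let ?C = "centralizer (InnGroup G) A"
  have sA: "subgroup A (InnGroup G)" using A by (simp add: splits_off_def)
  have C: "aut_invariant_subgroup G ?C"
    using aut_invariant_centralizer[of "{A}"] A by simp
  then have sC: "subgroup ?C (InnGroup G)" by (simp add: aut_invariant_subgroup_def)
  have AInn: "a \<in> carrier (InnGroup G)" if "a \<in> A" for a
    using that sA by (rule subgroup.mem_carrier[rotated])
  have A_auto [simp]: "a \<in> auto G" if "a \<in> A" for a
    using that AInn InnGroup_auto by auto
  have C_auto [simp]: "c \<in> auto G" if "c \<in> ?C" for c
    using that by (auto intro: InnGroup_auto dest: centralizer_carrier)
  have ex: "\<exists>a. a \<in> A \<and> (\<exists>c\<in>?C. conj_aut G k = a \<otimes>\<^bsub>AutoGroup G\<^esub> c)" if "k \<in> carrier G" for k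
    using that A(2) unfolding splits_off_def InnGroup_mult by (meson conj_aut_InnGroup)
  define \<gamma> where
    "\<gamma> = (\<lambda>k\<in>carrier G. SOME a. a \<in> A \<and> (\<exists>c\<in>?C. conj_aut G k = a \<otimes>\<^bsub>AutoGroup G\<^esub> c))"
  have \<gamma>: "\<gamma> k \<in> A" "\<exists>c\<in>?C. conj_aut G k = \<gamma> k \<otimes>\<^bsub>AutoGroup G\<^esub> c" if "k \<in> carrier G" for k
    using someI_ex[OF ex[OF that]] that by (auto simp: \<gamma>_def)
  have \<gamma>_eq: "\<gamma> k = a"
    if "k \<in> carrier G" "a \<in> A" "c \<in> ?C" "conj_aut G k = a \<otimes>\<^bsub>AutoGroup G\<^esub> c" for k a c
    using \<gamma>[OF that(1)] that Inn.factors_unique(1)[OF sA sC Inn.splits_off_Int[OF A(2)], of "\<gamma> k" a]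
    by auto
  have \<gamma>_auto [simp]: "\<gamma> k \<in> auto G" if "k \<in> carrier G" for k
    using \<gamma> that by simp
  have hom: "\<gamma> (k \<otimes> l) = \<gamma> k \<otimes>\<^bsub>AutoGroup G\<^esub> \<gamma> l" if [simp]: "k \<in> carrier G" "l \<in> carrier G" for k l
  proof -
    obtain c d where c: "c \<in> ?C" "conj_aut G k = \<gamma> k \<otimes>\<^bsub>AutoGroup G\<^esub> c"
      and d: "d \<in> ?C" "conj_aut G l = \<gamma> l \<otimes>\<^bsub>AutoGroup G\<^esub> d"
      using \<gamma>(2)[OF \<open>k \<in> carrier G\<close>] \<gamma>(2)[OF \<open>l \<in> carrier G\<close>] by blast
    have cl: "c \<otimes>\<^bsub>AutoGroup G\<^esub> \<gamma> l = \<gamma> l \<otimes>\<^bsub>AutoGroup G\<^esub> c"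
      using centralizer_commutes[OF c(1) \<gamma>(1)] by simp
    show ?thesis
    proof (rule \<gamma>_eq)
      show "\<gamma> k \<otimes>\<^bsub>AutoGroup G\<^esub> \<gamma> l \<in> A"
        using subgroup.m_closed[OF sA] \<gamma> by fastforce
      show "c \<otimes>\<^bsub>AutoGroup G\<^esub> d \<in> ?C"
        using subgroup.m_closed[OF sC c(1) d(1)] by simp
      \<comment> \<open>The inner pair is an element of the centralizer next to an element of
        \<open>A\<close>; swapping it by \<open>cl\<close> collects the two components.\<close>
      have "conj_aut G (k \<otimes> l) = \<gamma> k \<otimes>\<^bsub>AutoGroup G\<^esub> (c \<otimes>\<^bsub>AutoGroup G\<^esub> \<gamma> l) \<otimes>\<^bsub>AutoGroup G\<^esub> d"
        using c d by (simp add: conj_aut_mult Aut.m_assoc)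
      then show "conj_aut G (k \<otimes> l) = (\<gamma> k \<otimes>\<^bsub>AutoGroup G\<^esub> \<gamma> l) \<otimes>\<^bsub>AutoGroup G\<^esub> (c \<otimes>\<^bsub>AutoGroup G\<^esub> d)"
        unfolding cl using c d by (simp add: Aut.m_assoc)
    qed simp
  qed
  have equi: "\<gamma> (\<beta> k) \<otimes>\<^bsub>AutoGroup G\<^esub> \<beta> = \<beta> \<otimes>\<^bsub>AutoGroup G\<^esub> \<gamma> k"
    if [simp]: "\<beta> \<in> auto G" "k \<in> carrier G" for \<beta> k
  proof -
    obtain c where c: "c \<in> ?C" "conj_aut G k = \<gamma> k \<otimes>\<^bsub>AutoGroup G\<^esub> c"
      using \<gamma>(2)[OF \<open>k \<in> carrier G\<close>] by blast
    have "\<gamma> (\<beta> k) = \<beta> \<otimes>\<^bsub>AutoGroup G\<^esub> \<gamma> k \<otimes>\<^bsub>AutoGroup G\<^esub> inv\<^bsub>AutoGroup G\<^esub> \<beta>"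
    proof (rule \<gamma>_eq)
      show "\<beta> \<otimes>\<^bsub>AutoGroup G\<^esub> \<gamma> k \<otimes>\<^bsub>AutoGroup G\<^esub> inv\<^bsub>AutoGroup G\<^esub> \<beta> \<in> A"
        using A(1) \<gamma> by (simp add: aut_invariant_subgroup_def)
      show "\<beta> \<otimes>\<^bsub>AutoGroup G\<^esub> c \<otimes>\<^bsub>AutoGroup G\<^esub> inv\<^bsub>AutoGroup G\<^esub> \<beta> \<in> ?C"
        using C c by (simp add: aut_invariant_subgroup_def)
      have "conj_aut G (\<beta> k) = \<beta> \<otimes>\<^bsub>AutoGroup G\<^esub> conj_aut G k \<otimes>\<^bsub>AutoGroup G\<^esub> inv\<^bsub>AutoGroup G\<^esub> \<beta>"
        by (simp add: auto_conj_aut Aut.m_assoc)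
      then show "conj_aut G (\<beta> k) = (\<beta> \<otimes>\<^bsub>AutoGroup G\<^esub> \<gamma> k \<otimes>\<^bsub>AutoGroup G\<^esub> inv\<^bsub>AutoGroup G\<^esub> \<beta>)
          \<otimes>\<^bsub>AutoGroup G\<^esub> (\<beta> \<otimes>\<^bsub>AutoGroup G\<^esub> c \<otimes>\<^bsub>AutoGroup G\<^esub> inv\<^bsub>AutoGroup G\<^esub> \<beta>)"
        using c by (simp add: Aut.group_normalize)
    qed simp
    then show ?thesis by (simp add: Aut.m_assoc)
  qed
  have "\<gamma> \<in> equivariant_homs G"
    unfolding equivariant_homs_def
  proof (intro CollectI conjI IntI ballI)
    show "\<gamma> \<in> hom G (AutoGroup G)" by (rule homI) (simp_all add: hom)
    show "\<gamma> \<in> extensional (carrier G)" by (simp add: \<gamma>_def)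
  qed (rule equi)
  moreover have "a \<in> \<gamma> ` carrier G" if a: "a \<in> A" for a
  proof -
    obtain k where k: "k \<in> carrier G" "a = conj_aut G k"
      using AInn[OF a] by (auto simp: carrier_InnGroup)
    have "\<gamma> k = a"
      \<comment> \<open>An element of \<open>A\<close> has trivial component in the centralizer, so
        the projection fixes it.\<close>
      using k a subgroup.one_closed[OF sC] by (intro \<gamma>_eq[where c = "\<one>\<^bsub>AutoGroup G\<^esub>"]) auto
    then show ?thesis using k by blast
  qed
  ultimately show ?thesis using \<gamma> by blast
qed

lemma bij_betw_equivariant_homs_image:
  assumes "perfect_group G"
  shows "bij_betw (\<lambda>\<gamma>. \<gamma> ` carrier G) (equivariant_homs G)
    {A. aut_invariant_subgroup G A \<and> splits_off (InnGroup G) A}"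
  unfolding bij_betw_def
  using inj_on_equivariant_homs_image[OF assms] equivariant_homs_image[OF assms]
    equivariant_homs_projection[OF assms] by blast

end

section \<open>Regular normal subgroups of the holomorph\<close>

text \<open>For trivial \<gamma> these are the right translations, and for \<open>conj_aut G\<close>
  the left translations; general \<gamma> mixes the two.\<close>

definition twisted_regular :: "('a, 'b) monoid_scheme \<Rightarrow> ('a \<Rightarrow> 'a \<Rightarrow> 'a) \<Rightarrow> 'a \<Rightarrow> 'a \<Rightarrow> 'a" where
  "twisted_regular G \<gamma> g = (\<lambda>x\<in>carrier G. \<gamma> g x \<otimes>\<^bsub>G\<^esub> g)"

section \<open>Regular permutation groups in pointwise form\<close>

lemma carrier_BijGroup [simp]: "carrier (BijGroup E) = Bij E"
  by (simp add: BijGroup_def)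

lemma BijGroup_mult_apply:
  "f \<in> Bij E \<Longrightarrow> g \<in> Bij E \<Longrightarrow> x \<in> E \<Longrightarrow> (f \<otimes>\<^bsub>BijGroup E\<^esub> g) x = f (g x)"
  by (simp add: BijGroup_def compose_eq)

lemma BijGroup_one_apply: "x \<in> E \<Longrightarrow> \<one>\<^bsub>BijGroup E\<^esub> x = x"
  by (simp add: BijGroup_def)

lemma Bij_closed: "f \<in> Bij E \<Longrightarrow> x \<in> E \<Longrightarrow> f x \<in> E"
  by (auto dest: Bij_imp_funcset)

lemma Bij_eqI:
  assumes "f \<in> Bij E" "g \<in> Bij E" "\<And>x. x \<in> E \<Longrightarrow> f x = g x"
  shows "f = g"
  using assms by (auto intro: extensionalityI dest: Bij_imp_extensional)

lemma regular_subgroupD: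
  assumes "regular_subgroup E N"
  shows "subgroup N (BijGroup E)"
    and "\<And>x y. x \<in> E \<Longrightarrow> y \<in> E \<Longrightarrow> \<exists>f\<in>N. f x = y"
    and "\<And>f x. f \<in> N \<Longrightarrow> x \<in> E \<Longrightarrow> f x = x \<Longrightarrow> f = \<one>\<^bsub>BijGroup E\<^esub>"
proof -
  have "transitive_action (BijGroup E\<lparr>carrier := N\<rparr>) E (\<lambda>f. f)"
    using assms by (simp add: regular_subgroup_def)
  then show "\<exists>f\<in>N. f x = y" if "x \<in> E" "y \<in> E" for x y
    using transitive_action.unique_orbit that by fastforce
  show "subgroup N (BijGroup E)" using assms by (simp add: regular_subgroup_def)
  show "f = \<one>\<^bsub>BijGroup E\<^esub>" if "f \<in> N" "x \<in> E" "f x = x" for f x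
    using assms that by (auto simp: regular_subgroup_def stabilizer_def)
qed

lemma regular_subgroupI:
  assumes N: "subgroup N (BijGroup E)"
    and trans: "\<And>x y. x \<in> E \<Longrightarrow> y \<in> E \<Longrightarrow> \<exists>f\<in>N. f x = y"
    and free: "\<And>f x. f \<in> N \<Longrightarrow> x \<in> E \<Longrightarrow> f x = x \<Longrightarrow> f = \<one>\<^bsub>BijGroup E\<^esub>"
  shows "regular_subgroup E N"
proof -
  interpret B: group "BijGroup E" by (rule group_BijGroup)
  have "group_hom (BijGroup E\<lparr>carrier := N\<rparr>) (BijGroup E) (\<lambda>f. f)"
  proof (intro group_hom.intro group_hom_axioms.intro group_BijGroup B.subgroup_imp_group[OF N])
    show "(\<lambda>f. f) \<in> hom (BijGroup E\<lparr>carrier := N\<rparr>) (BijGroup E)"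
      by (rule homI) (simp_all add: subgroup.mem_carrier[OF N] del: carrier_BijGroup)
  qed
  then have "transitive_action (BijGroup E\<lparr>carrier := N\<rparr>) E (\<lambda>f. f)"
    using trans by (intro transitive_action.intro group_action.intro transitive_action_axioms.intro) simp_all
  moreover have "stabilizer (BijGroup E\<lparr>carrier := N\<rparr>) (\<lambda>f. f) x = {\<one>\<^bsub>BijGroup E\<^esub>}" if "x \<in> E" for x
  proof (intro subset_antisym subsetI)
    fix f assume "f \<in> stabilizer (BijGroup E\<lparr>carrier := N\<rparr>) (\<lambda>f. f) x"
    then have "f \<in> N" "f x = x" by (simp_all add: stabilizer_def)
    then show "f \<in> {\<one>\<^bsub>BijGroup E\<^esub>}"
      using free[OF _ that] by blast
  qed (use that subgroup.one_closed[OF N] in \<open>simp add: stabilizer_def BijGroup_one_apply\<close>)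
  ultimately show ?thesis
    unfolding regular_subgroup_def using N by blast
qed

text \<open>If \<open>f\<close> and \<open>g\<close> agree at \<open>x\<close>, then the inverse of
  \<open>g\<close> composed with \<open>f\<close> fixes \<open>x\<close>. One value thus determines
  an element.\<close>

lemma regular_subgroup_eqI:
  assumes N: "regular_subgroup E N" and f: "f \<in> N" and g: "g \<in> N" and "x \<in> E" "f x = g x"
  shows "f = g"
proof -
  interpret B: group "BijGroup E" by (rule group_BijGroup)
  interpret N: subgroup N "BijGroup E" by (rule regular_subgroupD(1)[OF N])
  have [simp]: "f \<in> Bij E" "g \<in> Bij E"
    using f g N.subset by auto
  have gi [simp]: "inv\<^bsub>BijGroup E\<^esub> g \<in> Bij E"
    using B.inv_closed[of g] by simp
  have "(inv\<^bsub>BijGroup E\<^esub> g \<otimes>\<^bsub>BijGroup E\<^esub> f) x = (inv\<^bsub>BijGroup E\<^esub> g) (g x)"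
    using assms by (simp add: BijGroup_mult_apply)
  also have "\<dots> = (inv\<^bsub>BijGroup E\<^esub> g \<otimes>\<^bsub>BijGroup E\<^esub> g) x"
    using assms by (intro BijGroup_mult_apply[symmetric]) simp_all
  also have "\<dots> = x"
    using assms by (simp add: BijGroup_one_apply)
  finally have "inv\<^bsub>BijGroup E\<^esub> g \<otimes>\<^bsub>BijGroup E\<^esub> f = \<one>\<^bsub>BijGroup E\<^esub>"
    using f g \<open>x \<in> E\<close> by (intro regular_subgroupD(3)[OF N]) auto
  then have "g \<otimes>\<^bsub>BijGroup E\<^esub> (inv\<^bsub>BijGroup E\<^esub> g \<otimes>\<^bsub>BijGroup E\<^esub> f) = g"
    by simp
  then show ?thesis
    by (simp add: B.mult_inv_cancel_left)
qed

context group
begin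

interpretation Bij: group "BijGroup (carrier G)"
  by (rule group_BijGroup)

lemmas Bij_group_closed [simp] =
  Bij.m_closed[simplified] Bij.inv_closed[simplified] Bij.one_closed[simplified]

section \<open>The holomorph, its automorphisms and its translations\<close>

lemma auto_Bij [simp]: "\<alpha> \<in> auto G \<Longrightarrow> \<alpha> \<in> Bij (carrier G)"
  by (simp add: auto_def)

lemma right_regular_apply: "x \<in> carrier G \<Longrightarrow> right_regular G g x = x \<otimes> g"
  by (simp add: right_regular_def)

lemma right_regular_Bij [simp]:
  assumes [simp]: "g \<in> carrier G"
  shows "right_regular G g \<in> Bij (carrier G)"
proof -
  have "bij_betw (right_regular G g) (carrier G) (carrier G)"
    by (rule bij_betw_byWitness[where f' = "right_regular G (inv g)"])
       (auto simp: right_regular_apply m_assoc)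
  then show ?thesis by (simp add: Bij_def right_regular_def)
qed

lemma right_regular_image_subset: "right_regular G ` carrier G \<subseteq> Bij (carrier G)"
  by auto

lemma holomorph_iff:
  "f \<in> holomorph G \<longleftrightarrow> f \<in> Bij (carrier G) \<and>
    (f <#\<^bsub>BijGroup (carrier G)\<^esub> right_regular G ` carrier G) #>\<^bsub>BijGroup (carrier G)\<^esub> inv\<^bsub>BijGroup (carrier G)\<^esub> f
      = right_regular G ` carrier G"
  by (simp add: holomorph_def normalizer_def stabilizer_def right_regular_image_subset)

lemma subgroup_holomorph: "subgroup (holomorph G) (BijGroup (carrier G))"
  unfolding holomorph_def by (rule Bij.normalizer_imp_subgroup) auto

lemma holomorph_Bij: "f \<in> holomorph G \<Longrightarrow> f \<in> Bij (carrier G)"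
  by (simp add: holomorph_iff)

text \<open>\<phi> records how conjugation by \<open>f\<close> permutes the right translations. Its
  surjectivity gives equality of the conjugated group with the original, as normalizing demands,
  rather than inclusion.\<close>

lemma holomorphI:
  assumes f [simp]: "f \<in> Bij (carrier G)" and \<phi>: "\<phi> ` carrier G = carrier G"
    and comm: "\<And>y. y \<in> carrier G \<Longrightarrow> f \<otimes>\<^bsub>BijGroup (carrier G)\<^esub> right_regular G y
      = right_regular G (\<phi> y) \<otimes>\<^bsub>BijGroup (carrier G)\<^esub> f"
  shows "f \<in> holomorph G"
proof -
  have "f \<otimes>\<^bsub>BijGroup (carrier G)\<^esub> right_regular G y \<otimes>\<^bsub>BijGroup (carrier G)\<^esub> inv\<^bsub>BijGroup (carrier G)\<^esub> f
      = right_regular G (\<phi> y)" if y: "y \<in> carrier G" for y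
  proof -
    have "\<phi> y \<in> carrier G" using \<phi> y by auto
    then show ?thesis using y by (simp add: comm Bij.m_assoc)
  qed
  then have "(f <#\<^bsub>BijGroup (carrier G)\<^esub> right_regular G ` carrier G) #>\<^bsub>BijGroup (carrier G)\<^esub> inv\<^bsub>BijGroup (carrier G)\<^esub> f
      = (\<lambda>y. right_regular G (\<phi> y)) ` carrier G"
    by (auto simp: l_coset_def r_coset_def)
  also have "\<dots> = right_regular G ` carrier G"
    using \<phi> by (metis image_image)
  finally show ?thesis by (simp add: holomorph_iff)
qed

lemma auto_holomorph:
  assumes \<alpha> [simp]: "\<alpha> \<in> auto G"
  shows "\<alpha> \<in> holomorph G"
proof (rule holomorphI)
  show "\<alpha> ` carrier G = carrier G"
    using \<alpha> by (simp add: auto_def Bij_def bij_betw_def)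
  show "\<alpha> \<otimes>\<^bsub>BijGroup (carrier G)\<^esub> right_regular G y
      = right_regular G (\<alpha> y) \<otimes>\<^bsub>BijGroup (carrier G)\<^esub> \<alpha>" if "y \<in> carrier G" for y
    using that by (intro Bij_eqI[of _ "carrier G"]) (simp_all add: BijGroup_mult_apply right_regular_apply auto_mult)
qed simp

lemma right_regular_holomorph:
  assumes [simp]: "g \<in> carrier G"
  shows "right_regular G g \<in> holomorph G"
proof (rule holomorphI)
  have "inner_aut G g = conj_aut G (inv g)"
    by (simp add: conj_aut_def)
  then have "inner_aut G g \<in> auto G" by simp
  then show "inner_aut G g ` carrier G = carrier G"
    by (simp add: auto_def Bij_def bij_betw_def)
  \<comment> \<open>Maps compose as functions, so conjugating by the translation by \<open>g\<close>
    acts on the index as \<open>inner_aut G g\<close>: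
    \<open>x y g = (x g) (inv g y g)\<close>.\<close>
  show "right_regular G g \<otimes>\<^bsub>BijGroup (carrier G)\<^esub> right_regular G y
      = right_regular G (inner_aut G g y) \<otimes>\<^bsub>BijGroup (carrier G)\<^esub> right_regular G g"
    if "y \<in> carrier G" for y
    using that by (intro Bij_eqI[of _ "carrier G"])
      (simp_all add: BijGroup_mult_apply right_regular_apply inner_aut_def group_normalize)
qed simp

text \<open>Normalizing moves \<open>f\<close> past the translation by \<open>y\<close>, turning it
  into a translation by some \<open>w\<close>; evaluation at \<one> identifies \<open>w\<close> as
  \<open>inv (f \<one>) \<otimes> f y\<close>.\<close>

lemma holomorph_apply_mult:
  assumes f: "f \<in> holomorph G" and [simp]: "x \<in> carrier G" "y \<in> carrier G"
  shows "f (x \<otimes> y) = f x \<otimes> inv (f \<one>) \<otimes> f y"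
proof -
  have [simp]: "f \<in> Bij (carrier G)" using f by (rule holomorph_Bij)
  have fc [simp]: "f z \<in> carrier G" if "z \<in> carrier G" for z
    using that Bij_closed[of f] by simp
  have "f \<otimes>\<^bsub>BijGroup (carrier G)\<^esub> right_regular G y \<otimes>\<^bsub>BijGroup (carrier G)\<^esub> inv\<^bsub>BijGroup (carrier G)\<^esub> f
      \<in> (f <#\<^bsub>BijGroup (carrier G)\<^esub> right_regular G ` carrier G) #>\<^bsub>BijGroup (carrier G)\<^esub> inv\<^bsub>BijGroup (carrier G)\<^esub> f"
    using \<open>y \<in> carrier G\<close> unfolding l_coset_def r_coset_def by blast
  then have "f \<otimes>\<^bsub>BijGroup (carrier G)\<^esub> right_regular G y \<otimes>\<^bsub>BijGroup (carrier G)\<^esub> inv\<^bsub>BijGroup (carrier G)\<^esub> f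
      \<in> right_regular G ` carrier G"
    using f by (simp add: holomorph_iff)
  then obtain w where w [simp]: "w \<in> carrier G"
    and eq: "f \<otimes>\<^bsub>BijGroup (carrier G)\<^esub> right_regular G y \<otimes>\<^bsub>BijGroup (carrier G)\<^esub> inv\<^bsub>BijGroup (carrier G)\<^esub> f
      = right_regular G w" by auto
  have comm: "f \<otimes>\<^bsub>BijGroup (carrier G)\<^esub> right_regular G y = right_regular G w \<otimes>\<^bsub>BijGroup (carrier G)\<^esub> f"
    unfolding eq[symmetric] by (simp add: Bij.m_assoc)
  have fy: "f (z \<otimes> y) = f z \<otimes> w" if "z \<in> carrier G" for z
    using that fun_cong[OF comm, of z] by (simp add: BijGroup_mult_apply right_regular_apply)
  have "f y = f \<one> \<otimes> w" using fy[of \<one>] by simp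
  then have "inv (f \<one>) \<otimes> f y = w" by (simp add: inv_mult_cancel_left)
  then show ?thesis by (simp add: fy m_assoc)
qed

text \<open>Every element of the holomorph is an automorphism followed by the right translation by
  its value at \<one>.\<close>

lemma holomorph_auto:
  assumes f: "f \<in> holomorph G"
  shows "(\<lambda>x\<in>carrier G. f x \<otimes> inv (f \<one>)) \<in> auto G"
proof -
  let ?\<alpha> = "\<lambda>x\<in>carrier G. f x \<otimes> inv (f \<one>)"
  have fB [simp]: "f \<in> Bij (carrier G)" using f by (rule holomorph_Bij)
  have fc [simp]: "f z \<in> carrier G" if "z \<in> carrier G" for z
    using that Bij_closed[of f] by simp
  have "?\<alpha> \<in> hom G G"
    by (rule homI) (simp_all add: holomorph_apply_mult[OF f] m_assoc)
  moreover have "?\<alpha> = right_regular G (inv (f \<one>)) \<otimes>\<^bsub>BijGroup (carrier G)\<^esub> f"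
    by (rule extensionalityI[of _ "carrier G"])
       (simp_all add: BijGroup_mult_apply right_regular_apply Bij_imp_extensional)
  ultimately show ?thesis by (simp add: auto_def)
qed

section \<open>Twisted translations and normal subgroups of the holomorph\<close>

lemma twisted_regular_eq:
  assumes "\<gamma> g \<in> auto G" "g \<in> carrier G"
  shows "twisted_regular G \<gamma> g = right_regular G g \<otimes>\<^bsub>BijGroup (carrier G)\<^esub> \<gamma> g"
proof (rule extensionalityI[of _ "carrier G"])
  show "right_regular G g \<otimes>\<^bsub>BijGroup (carrier G)\<^esub> \<gamma> g \<in> extensional (carrier G)"
    using assms by (intro Bij_imp_extensional) simp
qed (use assms in \<open>simp_all add: twisted_regular_def BijGroup_mult_apply right_regular_apply\<close>)

lemma twisted_regular_holomorph:
  assumes "\<gamma> g \<in> auto G" "g \<in> carrier G"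
  shows "twisted_regular G \<gamma> g \<in> holomorph G"
  using assms subgroup.m_closed[OF subgroup_holomorph]
  by (simp add: twisted_regular_eq right_regular_holomorph auto_holomorph)

lemma twisted_regular_apply: "x \<in> carrier G \<Longrightarrow> twisted_regular G \<gamma> g x = \<gamma> g x \<otimes> g"
  by (simp add: twisted_regular_def)

text \<open>The swap form \<open>f n = m f\<close> can be checked pointwise without computing any
  inverse permutation.\<close>

lemma normal_HolGroupI:
  assumes N: "subgroup N (BijGroup (carrier G))" "N \<subseteq> holomorph G"
    and conj: "\<And>f n. f \<in> holomorph G \<Longrightarrow> n \<in> N \<Longrightarrow>
      \<exists>m\<in>N. f \<otimes>\<^bsub>BijGroup (carrier G)\<^esub> n = m \<otimes>\<^bsub>BijGroup (carrier G)\<^esub> f"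
  shows "N \<lhd> HolGroup G"
proof -
  have H: "group (HolGroup G)"
    unfolding HolGroup_def by (rule Bij.subgroup_imp_group[OF subgroup_holomorph])
  have sub: "subgroup N (HolGroup G)"
    unfolding HolGroup_def by (rule Bij.subgroup_incl[OF N(1) subgroup_holomorph N(2)])
  have "f \<otimes>\<^bsub>BijGroup (carrier G)\<^esub> n \<otimes>\<^bsub>BijGroup (carrier G)\<^esub> inv\<^bsub>BijGroup (carrier G)\<^esub> f \<in> N"
    if f: "f \<in> holomorph G" and n: "n \<in> N" for f n
  proof -
    obtain m where m: "m \<in> N" "f \<otimes>\<^bsub>BijGroup (carrier G)\<^esub> n = m \<otimes>\<^bsub>BijGroup (carrier G)\<^esub> f"
      using conj[OF f n] by blast
    have "m \<in> Bij (carrier G)" "f \<in> Bij (carrier G)"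
      using m N(2) f holomorph_Bij by auto
    with m show ?thesis by (simp add: Bij.m_assoc)
  qed
  then show ?thesis
    using sub Bij.m_inv_consistent[OF subgroup_holomorph]
    by (simp add: group.normal_inv_iff[OF H]) (simp add: HolGroup_def)
qed

lemma normal_HolGroup_subset: "N \<lhd> HolGroup G \<Longrightarrow> N \<subseteq> holomorph G"
  using subgroup.subset[OF normal_imp_subgroup[of N "HolGroup G"]] by (simp add: HolGroup_def)

lemma normal_HolGroup_swap:
  assumes N: "N \<lhd> HolGroup G" and f: "f \<in> holomorph G" and n: "n \<in> N"
  shows "\<exists>m\<in>N. f \<otimes>\<^bsub>BijGroup (carrier G)\<^esub> n = m \<otimes>\<^bsub>BijGroup (carrier G)\<^esub> f"
proof -
  have "f \<otimes>\<^bsub>HolGroup G\<^esub> n \<otimes>\<^bsub>HolGroup G\<^esub> inv\<^bsub>HolGroup G\<^esub> f \<in> N"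
    using normal.inv_op_closed2[OF N] f n by (simp add: HolGroup_def)
  then have "f \<otimes>\<^bsub>BijGroup (carrier G)\<^esub> n \<otimes>\<^bsub>BijGroup (carrier G)\<^esub> inv\<^bsub>BijGroup (carrier G)\<^esub> f \<in> N"
    using Bij.m_inv_consistent[OF subgroup_holomorph f] by (simp add: HolGroup_def)
  moreover have "f \<in> Bij (carrier G)" "n \<in> Bij (carrier G)"
    using f n normal_HolGroup_subset[OF N] holomorph_Bij by auto
  ultimately show "\<exists>m\<in>N. f \<otimes>\<^bsub>BijGroup (carrier G)\<^esub> n = m \<otimes>\<^bsub>BijGroup (carrier G)\<^esub> f"
    by (intro bexI) (auto simp: Bij.m_assoc)
qed

lemma twisted_regular_image:
  assumes \<gamma>: "\<gamma> \<in> equivariant_homs G"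
  shows "twisted_regular G \<gamma> ` carrier G \<in> regular_normal_subgroups G"
proof -
  interpret Aut: group "AutoGroup G" by (rule AutoGroup)
  let ?\<nu> = "twisted_regular G \<gamma>" and ?N = "twisted_regular G \<gamma> ` carrier G"
  note [simp] = equivariant_homs_auto[OF \<gamma>]
  have Hol: "?\<nu> g \<in> holomorph G" if "g \<in> carrier G" for g
    using that by (simp add: twisted_regular_holomorph)
  have Bij [simp]: "?\<nu> g \<in> Bij (carrier G)" if "g \<in> carrier G" for g
    using Hol[OF that] by (rule holomorph_Bij)
  have \<gamma>_mult: "\<gamma> (g \<otimes> h) x = \<gamma> g (\<gamma> h x)"
    if "g \<in> carrier G" "h \<in> carrier G" "x \<in> carrier G" for g h x
    using that by (simp add: equivariant_homs_mult[OF \<gamma>] AutoGroup_mult_apply)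
  have \<gamma>_equi: "\<gamma> (\<beta> g) (\<beta> x) = \<beta> (\<gamma> g x)"
    if "\<beta> \<in> auto G" "g \<in> carrier G" "x \<in> carrier G" for \<beta> g x
    using that fun_cong[OF equivariant_homs_equivariant[OF \<gamma>, of \<beta> g], of x]
    by (simp add: AutoGroup_mult_apply)
  have \<gamma>_one: "\<gamma> \<one> x = x" if "x \<in> carrier G" for x
    using that group_hom.hom_one[OF equivariant_homs_group_hom[OF \<gamma>]]
    by (simp add: AutoGroup_def BijGroup_def)
  have \<gamma>_inv: "\<gamma> (inv g) (\<gamma> g x) = x" "\<gamma> g (\<gamma> (inv g) x) = x"
    if "g \<in> carrier G" "x \<in> carrier G" for g x
    using that by (simp_all add: \<gamma>_mult[symmetric] \<gamma>_one)
  \<comment> \<open>Multiplicativity of \<gamma> together with equivariance under the automorphism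
    \<open>\<gamma> h\<close> makes the set of twisted translations closed under
    composition.\<close>
  have mult: "?\<nu> h \<otimes>\<^bsub>BijGroup (carrier G)\<^esub> ?\<nu> g = ?\<nu> (\<gamma> h g \<otimes> h)"
    if [simp]: "g \<in> carrier G" "h \<in> carrier G" for g h
  proof (rule Bij_eqI[of _ "carrier G"])
    fix x assume [simp]: "x \<in> carrier G"
    have "\<gamma> (\<gamma> h g \<otimes> h) x = \<gamma> (\<gamma> h g) (\<gamma> h x)"
      by (simp add: \<gamma>_mult)
    also have "\<dots> = \<gamma> h (\<gamma> g x)" by (simp add: \<gamma>_equi)
    finally show "(?\<nu> h \<otimes>\<^bsub>BijGroup (carrier G)\<^esub> ?\<nu> g) x = ?\<nu> (\<gamma> h g \<otimes> h) x"
      by (simp add: BijGroup_mult_apply twisted_regular_apply auto_mult m_assoc)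
  qed simp_all
  have one: "?\<nu> \<one> = \<one>\<^bsub>BijGroup (carrier G)\<^esub>"
    by (rule Bij_eqI[of _ "carrier G"]) (simp_all add: twisted_regular_apply \<gamma>_one BijGroup_one_apply)
  have sub: "subgroup ?N (BijGroup (carrier G))"
  proof (rule Bij.subgroupI)
    fix f assume "f \<in> ?N"
    then obtain g where [simp]: "g \<in> carrier G" and f: "f = ?\<nu> g" by auto
    \<comment> \<open>Solves \<open>\<gamma> g h \<otimes> g = \<one>\<close> for \<open>h\<close>,
      which by \<open>mult\<close> gives the inverse.\<close>
    let ?h = "\<gamma> (inv g) (inv g)"
    have "?\<nu> g \<otimes>\<^bsub>BijGroup (carrier G)\<^esub> ?\<nu> ?h = \<one>\<^bsub>BijGroup (carrier G)\<^esub>"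
      by (simp add: mult \<gamma>_inv one)
    then have "inv\<^bsub>BijGroup (carrier G)\<^esub> f = ?\<nu> ?h"
      unfolding f by (intro Bij.inv_unique'[symmetric, simplified]) (simp_all add: Bij.inv_comm)
    then show "inv\<^bsub>BijGroup (carrier G)\<^esub> f \<in> ?N" by simp
  next
    fix f f' assume "f \<in> ?N" "f' \<in> ?N"
    then show "f \<otimes>\<^bsub>BijGroup (carrier G)\<^esub> f' \<in> ?N" by (auto simp: mult)
  qed (auto intro: one_closed)
  interpret N: subgroup ?N "BijGroup (carrier G)" by (rule sub)
  have at_one: "?\<nu> g \<one> = g" if "g \<in> carrier G" for g
    using that by (simp add: twisted_regular_apply auto_one)
  have regular: "regular_subgroup (carrier G) ?N"
  proof (rule regular_subgroupI[OF sub])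
    fix x y assume [simp]: "x \<in> carrier G" "y \<in> carrier G"
    \<comment> \<open>Sends \<open>x\<close> to \<one> and then \<one> to \<open>y\<close>.\<close>
    let ?f = "?\<nu> y \<otimes>\<^bsub>BijGroup (carrier G)\<^esub> inv\<^bsub>BijGroup (carrier G)\<^esub> ?\<nu> x"
    have "?f \<in> ?N" by (intro N.m_closed N.m_inv_closed) auto
    moreover have "(?f \<otimes>\<^bsub>BijGroup (carrier G)\<^esub> ?\<nu> x) \<one> = ?f x"
      by (subst BijGroup_mult_apply) (simp_all add: at_one)
    then have "?f x = y" by (simp add: Bij.m_assoc at_one)
    ultimately show "\<exists>f\<in>?N. f x = y" by blast
  next
    fix f x assume "f \<in> ?N" and [simp]: "x \<in> carrier G" and fx: "f x = x"
    then obtain g where [simp]: "g \<in> carrier G" and f: "f = ?\<nu> g" by auto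
    \<comment> \<open>If the twisted translation by \<open>g\<close> fixes \<open>x\<close>, then
      composing it with the one by \<open>x\<close> gives the one by \<open>x\<close> again, and
      cancellation leaves the identity.\<close>
    have m: "?\<nu> g \<otimes>\<^bsub>BijGroup (carrier G)\<^esub> ?\<nu> x = ?\<nu> (\<gamma> g x \<otimes> g)"
      by (rule mult) simp_all
    also have "\<gamma> g x \<otimes> g = x" using fx by (simp add: f twisted_regular_apply)
    finally show "f = \<one>\<^bsub>BijGroup (carrier G)\<^esub>" by (simp add: f)
  qed
  have "?N \<lhd> HolGroup G"
  proof (rule normal_HolGroupI[OF sub])
    show "?N \<subseteq> holomorph G" using Hol by auto
    fix f n assume f: "f \<in> holomorph G" and "n \<in> ?N"
    then obtain g where [simp]: "g \<in> carrier G" and n: "n = ?\<nu> g" by auto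
    have fB [simp]: "f \<in> Bij (carrier G)" using f by (rule holomorph_Bij)
    define k where "k = f \<one>"
    have [simp]: "k \<in> carrier G" by (simp add: k_def Bij_closed)
    define \<alpha> where "\<alpha> = (\<lambda>x\<in>carrier G. f x \<otimes> inv k)"
    have \<alpha> [simp]: "\<alpha> \<in> auto G" unfolding \<alpha>_def k_def by (rule holomorph_auto[OF f])
    have f_apply: "f x = \<alpha> x \<otimes> k" if "x \<in> carrier G" for x
      using that by (simp add: \<alpha>_def m_assoc Bij_closed)
    \<comment> \<open>Found by evaluating \<open>f n = m f\<close> at \<one>, under the expectation
      \<open>\<gamma> m = \<gamma> (\<alpha> g)\<close> confirmed next.\<close>
    define m where "m = inv (\<gamma> (\<alpha> g) k) \<otimes> \<alpha> g \<otimes> k"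
    have [simp]: "m \<in> carrier G" by (simp add: m_def)
    have \<gamma>m: "\<gamma> m x = \<gamma> (\<alpha> g) x" if [simp]: "x \<in> carrier G" for x
    proof -
      \<comment> \<open>Equivariance under the automorphism \<open>\<gamma> (\<alpha> g)\<close>
        makes \<gamma> at \<open>\<gamma> (\<alpha> g) k\<close> a conjugate of
        \<open>\<gamma> k\<close>, so the contributions of \<open>k\<close> to
        \<open>\<gamma> m\<close> cancel.\<close>
      have "\<gamma> (\<gamma> (\<alpha> g) k) (\<gamma> (\<alpha> g) x) = \<gamma> (\<alpha> g) (\<gamma> k x)" by (simp add: \<gamma>_equi)
      then have "\<gamma> (inv (\<gamma> (\<alpha> g) k)) (\<gamma> (\<alpha> g) (\<gamma> k x)) = \<gamma> (\<alpha> g) x"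
        by (metis \<gamma>_inv(1) \<open>g \<in> carrier G\<close> \<open>k \<in> carrier G\<close> \<alpha> auto_closed equivariant_homs_auto[OF \<gamma>] that)
      then show ?thesis by (simp add: m_def \<gamma>_mult)
    qed
    have "f \<otimes>\<^bsub>BijGroup (carrier G)\<^esub> ?\<nu> g = ?\<nu> m \<otimes>\<^bsub>BijGroup (carrier G)\<^esub> f"
    proof (rule Bij_eqI[of _ "carrier G"])
      fix x assume [simp]: "x \<in> carrier G"
      have "(?\<nu> m \<otimes>\<^bsub>BijGroup (carrier G)\<^esub> f) x = \<gamma> (\<alpha> g) (\<alpha> x) \<otimes> \<gamma> (\<alpha> g) k \<otimes> m"
        by (simp add: BijGroup_mult_apply twisted_regular_apply f_apply \<gamma>m auto_mult)
      also have "\<dots> = \<alpha> (\<gamma> g x) \<otimes> \<alpha> g \<otimes> k"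
        by (simp add: m_def \<gamma>_equi group_normalize)
      also have "\<dots> = (f \<otimes>\<^bsub>BijGroup (carrier G)\<^esub> ?\<nu> g) x"
        by (simp add: BijGroup_mult_apply twisted_regular_apply f_apply auto_mult)
      finally show "(f \<otimes>\<^bsub>BijGroup (carrier G)\<^esub> ?\<nu> g) x = (?\<nu> m \<otimes>\<^bsub>BijGroup (carrier G)\<^esub> f) x" ..
    qed simp_all
    then show "\<exists>m\<in>?N. f \<otimes>\<^bsub>BijGroup (carrier G)\<^esub> n = m \<otimes>\<^bsub>BijGroup (carrier G)\<^esub> f"
      using n by auto
  qed
  with regular show ?thesis by (simp add: regular_normal_subgroups_def)
qed

lemma inj_on_twisted_regular_image:
  "inj_on (\<lambda>\<gamma>. twisted_regular G \<gamma> ` carrier G) (equivariant_homs G)"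
proof (rule inj_onI)
  fix \<gamma> \<delta> assume \<gamma>: "\<gamma> \<in> equivariant_homs G" and \<delta>: "\<delta> \<in> equivariant_homs G"
    and eq: "twisted_regular G \<gamma> ` carrier G = twisted_regular G \<delta> ` carrier G"
  note [simp] = equivariant_homs_auto[OF \<gamma>] equivariant_homs_auto[OF \<delta>]
  have "\<gamma> g = \<delta> g" if g [simp]: "g \<in> carrier G" for g
  proof -
    obtain h where [simp]: "h \<in> carrier G" and h: "twisted_regular G \<gamma> g = twisted_regular G \<delta> h"
      using eq g by blast
    have e: "\<gamma> g x \<otimes> g = \<delta> h x \<otimes> h" if "x \<in> carrier G" for x
      using that fun_cong[OF h, of x] by (simp add: twisted_regular_apply)
    \<comment> \<open>Automorphisms fix \<one>, so evaluation there recovers the index; cancelling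
      it leaves the automorphism.\<close>
    have "g = h" using e[of \<one>] by (simp add: auto_one)
    then show ?thesis
      using e by (intro auto_eqI) simp_all
  qed
  then show "\<gamma> = \<delta>"
    using \<gamma> \<delta> by (auto simp: equivariant_homs_def intro: extensionalityI)
qed

text \<open>Regularity indexes \<open>N\<close> by values at \<one>. Invariance under automorphisms
  yields equivariance, closure under composition yields the rule \<open>anti\<close>, and invariance
  under right translations converts \<open>anti\<close> into multiplicativity.\<close>

lemma regular_normal_subgroup_twisted:
  assumes N: "N \<in> regular_normal_subgroups G"
  shows "\<exists>\<gamma>\<in>equivariant_homs G. twisted_regular G \<gamma> ` carrier G = N"
proof -
  have reg: "regular_subgroup (carrier G) N" and nor: "N \<lhd> HolGroup G"
    using N by (auto simp: regular_normal_subgroups_def)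
  interpret N: subgroup N "BijGroup (carrier G)" by (rule regular_subgroupD(1)[OF reg])
  have NHol: "n \<in> holomorph G" if "n \<in> N" for n
    using that normal_HolGroup_subset[OF nor] by auto
  have NBij: "n \<in> Bij (carrier G)" if "n \<in> N" for n
    using NHol[OF that] by (rule holomorph_Bij)
  have "\<forall>g\<in>carrier G. \<exists>n\<in>N. n \<one> = g"
    using regular_subgroupD(2)[OF reg] by blast
  then obtain \<nu> where \<nu>: "\<And>g. g \<in> carrier G \<Longrightarrow> \<nu> g \<in> N" "\<And>g. g \<in> carrier G \<Longrightarrow> \<nu> g \<one> = g"
    by metis
  have [simp]: "\<nu> g \<in> Bij (carrier G)" if "g \<in> carrier G" for g
    using \<nu>(1)[OF that] by (rule NBij)
  have [simp]: "\<nu> g x \<in> carrier G" if "g \<in> carrier G" "x \<in> carrier G" for g x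
    using that by (simp add: Bij_closed)
  have N_eq: "n = \<nu> (n \<one>)" if n: "n \<in> N" for n
  proof (rule regular_subgroup_eqI[OF reg n])
    have "n \<one> \<in> carrier G" using NBij[OF n] by (simp add: Bij_closed)
    then show "\<nu> (n \<one>) \<in> N" "n \<one> = \<nu> (n \<one>) \<one>" by (simp_all add: \<nu>)
  qed simp
  \<comment> \<open>The automorphism part of \<open>\<nu> g\<close>, whose value at \<one> is
    \<open>g\<close>.\<close>
  define \<gamma> where "\<gamma> = (\<lambda>g\<in>carrier G. \<lambda>x\<in>carrier G. \<nu> g x \<otimes> inv g)"
  have \<gamma>_auto [simp]: "\<gamma> g \<in> auto G" if "g \<in> carrier G" for g
    using holomorph_auto[OF NHol[OF \<nu>(1)[OF that]]] that by (simp add: \<gamma>_def \<nu>)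
  have \<nu>_apply: "\<nu> g x = \<gamma> g x \<otimes> g" if "g \<in> carrier G" "x \<in> carrier G" for g x
    using that by (simp add: \<gamma>_def m_assoc)
  have \<nu>_twisted: "\<nu> g = twisted_regular G \<gamma> g" if [simp]: "g \<in> carrier G" for g
    by (rule extensionalityI[of _ "carrier G"])
      (simp_all add: \<nu>_apply twisted_regular_apply Bij_imp_extensional, simp add: twisted_regular_def)
  have swap: "\<exists>h\<in>carrier G. f \<otimes>\<^bsub>BijGroup (carrier G)\<^esub> \<nu> g = \<nu> h \<otimes>\<^bsub>BijGroup (carrier G)\<^esub> f"
    if f: "f \<in> holomorph G" and g: "g \<in> carrier G" for f g
  proof -
    obtain n where n: "n \<in> N" "f \<otimes>\<^bsub>BijGroup (carrier G)\<^esub> \<nu> g = n \<otimes>\<^bsub>BijGroup (carrier G)\<^esub> f"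
      using normal_HolGroup_swap[OF nor f \<nu>(1)[OF g]] by blast
    moreover have "n \<one> \<in> carrier G" using NBij[OF n(1)] by (simp add: Bij_closed)
    ultimately show ?thesis using N_eq by metis
  qed
  have equi: "\<gamma> (\<beta> g) \<otimes>\<^bsub>AutoGroup G\<^esub> \<beta> = \<beta> \<otimes>\<^bsub>AutoGroup G\<^esub> \<gamma> g"
    if \<beta> [simp]: "\<beta> \<in> auto G" and g [simp]: "g \<in> carrier G" for \<beta> g
  proof (rule auto_eqI)
    obtain h where [simp]: "h \<in> carrier G"
      and h: "\<beta> \<otimes>\<^bsub>BijGroup (carrier G)\<^esub> \<nu> g = \<nu> h \<otimes>\<^bsub>BijGroup (carrier G)\<^esub> \<beta>"
      using swap[OF auto_holomorph[OF \<beta>] g] by blast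
    have e: "\<beta> (\<gamma> g x) \<otimes> \<beta> g = \<gamma> h (\<beta> x) \<otimes> h" if "x \<in> carrier G" for x
      using that fun_cong[OF h, of x] by (simp add: BijGroup_mult_apply \<nu>_apply auto_mult)
    have "\<beta> g = h" using e[of \<one>] by (simp add: auto_one)
    then show "(\<gamma> (\<beta> g) \<otimes>\<^bsub>AutoGroup G\<^esub> \<beta>) x = (\<beta> \<otimes>\<^bsub>AutoGroup G\<^esub> \<gamma> g) x"
      if "x \<in> carrier G" for x
      using that e[OF that] by (simp add: AutoGroup_mult_apply)
  qed (use AutoGroup in \<open>simp_all add: group.is_monoid monoid.m_closed[of "AutoGroup G", simplified]\<close>)
  \<comment> \<open>The composite of \<open>\<nu> h\<close> and \<open>\<nu> g\<close> lies in
    \<open>N\<close> and sends \<one> to \<open>\<gamma> h g \<otimes> h\<close>, so it is the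
    element with that index.\<close>
  have anti: "\<gamma> (\<gamma> h g \<otimes> h) x = \<gamma> h (\<gamma> g x)"
    if [simp]: "g \<in> carrier G" "h \<in> carrier G" "x \<in> carrier G" for g h x
  proof -
    have "\<nu> h \<otimes>\<^bsub>BijGroup (carrier G)\<^esub> \<nu> g \<in> N" by (simp add: \<nu>)
    from N_eq[OF this] have e: "\<nu> h \<otimes>\<^bsub>BijGroup (carrier G)\<^esub> \<nu> g = \<nu> (\<gamma> h g \<otimes> h)"
      by (simp add: BijGroup_mult_apply \<nu> \<nu>_apply auto_one)
    have "\<gamma> (\<gamma> h g \<otimes> h) x \<otimes> (\<gamma> h g \<otimes> h) = \<gamma> h (\<gamma> g x) \<otimes> (\<gamma> h g \<otimes> h)"
      using fun_cong[OF e, of x] by (simp add: BijGroup_mult_apply \<nu>_apply auto_mult m_assoc)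
    then show ?thesis by simp
  qed
  have hom: "\<gamma> (m \<otimes> h) = \<gamma> m \<otimes>\<^bsub>AutoGroup G\<^esub> \<gamma> h"
    if m [simp]: "m \<in> carrier G" and h [simp]: "h \<in> carrier G" for m h
  proof (rule auto_eqI)
    \<comment> \<open>Comparing values at \<one> gives
      \<open>m \<otimes> h = \<gamma> g h \<otimes> g\<close>, and then at general \<open>x\<close>
      gives \<open>\<gamma> m = \<gamma> g\<close>; \<open>anti\<close> evaluates \<gamma> at this
      product.\<close>
    obtain g where [simp]: "g \<in> carrier G"
      and g: "right_regular G h \<otimes>\<^bsub>BijGroup (carrier G)\<^esub> \<nu> m = \<nu> g \<otimes>\<^bsub>BijGroup (carrier G)\<^esub> right_regular G h"
      using swap[OF right_regular_holomorph[OF h] m] by blast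
    have e: "\<gamma> m x \<otimes> (m \<otimes> h) = \<gamma> g x \<otimes> (\<gamma> g h \<otimes> g)" if "x \<in> carrier G" for x
      using that fun_cong[OF g, of x]
      by (simp add: BijGroup_mult_apply \<nu>_apply right_regular_apply auto_mult m_assoc)
    have mh: "m \<otimes> h = \<gamma> g h \<otimes> g" using e[of \<one>] by (simp add: auto_one)
    have gm: "\<gamma> m x = \<gamma> g x" if "x \<in> carrier G" for x
      using e[OF that] that unfolding mh by simp
    show "\<gamma> (m \<otimes> h) x = (\<gamma> m \<otimes>\<^bsub>AutoGroup G\<^esub> \<gamma> h) x" if "x \<in> carrier G" for x
      using that unfolding mh by (simp add: anti AutoGroup_mult_apply gm)
  qed (use AutoGroup in \<open>simp_all add: group.is_monoid monoid.m_closed[of "AutoGroup G", simplified]\<close>)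
  have "\<gamma> \<in> equivariant_homs G"
    unfolding equivariant_homs_def
  proof (intro CollectI conjI IntI ballI)
    show "\<gamma> \<in> hom G (AutoGroup G)" by (rule homI) (simp_all add: hom)
    show "\<gamma> \<in> extensional (carrier G)" by (simp add: \<gamma>_def)
  qed (rule equi)
  moreover have "\<nu> ` carrier G = N"
  proof (intro subset_antisym subsetI)
    fix n assume n: "n \<in> N"
    have "n \<one> \<in> carrier G" using NBij[OF n] by (simp add: Bij_closed)
    then show "n \<in> \<nu> ` carrier G" using N_eq[OF n] by blast
  qed (use \<nu> in auto)
  then have "twisted_regular G \<gamma> ` carrier G = N"
    using \<nu>_twisted by (metis (no_types, lifting) image_cong)
  ultimately show ?thesis by blast
qed

lemma bij_betw_twisted_regular_image:
  "bij_betw (\<lambda>\<gamma>. twisted_regular G \<gamma> ` carrier G) (equivariant_homs G) (regular_normal_subgroups G)"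
  unfolding bij_betw_def
  using inj_on_twisted_regular_image twisted_regular_image regular_normal_subgroup_twisted by blast

end

theorem theorem7p8:
  fixes G :: "('a, 'b) monoid_scheme"
    and As :: "('a \<Rightarrow> 'a) set list"
    and n :: nat
  assumes "group G"
    and "finite (carrier G)"
    and "perfect_group G"
    and "krs_decomposition G As"
    and "n = length As"
  shows "card (regular_normal_subgroups G) = 2 ^ n"
proof -
  interpret group G by fact
  interpret Inn: centreless_group "InnGroup G"
    by (rule centreless_InnGroup) fact
  have "bij_betw (\<lambda>I. centralizer (InnGroup G) (\<Union>j\<in>{..<length As} - I. As ! j))
      (Pow {..<length As}) {A. aut_invariant_subgroup G A \<and> splits_off (InnGroup G) A}"
  \<comment> \<open>The abstract predicate becomes invariance under all automorphisms of
    \<open>G\<close>, so indecomposability is meant relative to the operator group.\<close>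
  proof (rule Inn.bij_betw_indecomposable_factors)
    show "internal_direct_product (InnGroup G) As"
      using assms(4) by (simp add: krs_decomposition_def)
    show "aut_invariant_subgroup G A" "A \<noteq> {\<one>\<^bsub>InnGroup G\<^esub>}" if "A \<in> set As" for A
      using assms(4) that unfolding krs_decomposition_def by blast+
    show "B = {\<one>\<^bsub>InnGroup G\<^esub>} \<or> C = {\<one>\<^bsub>InnGroup G\<^esub>}"
      if "A \<in> set As" "aut_invariant_subgroup G B" "aut_invariant_subgroup G C"
        "internal_direct_product (InnGroup G\<lparr>carrier := A\<rparr>) [B, C]" for A B C
      using assms(4) that unfolding krs_decomposition_def aut_decomposable_def by blast
  qed (fact aut_invariant_normal aut_invariant_inter aut_invariant_centralizer)+
  then have "card {A. aut_invariant_subgroup G A \<and> splits_off (InnGroup G) A} = 2 ^ n"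
    using assms(5) bij_betw_same_card by (fastforce simp: card_Pow)
  moreover have "card (equivariant_homs G) = card (regular_normal_subgroups G)"
    by (rule bij_betw_same_card[OF bij_betw_twisted_regular_image])
  moreover have "card (equivariant_homs G) = card {A. aut_invariant_subgroup G A \<and> splits_off (InnGroup G) A}"
    by (rule bij_betw_same_card[OF bij_betw_equivariant_homs_image]) fact
  ultimately show ?thesis by simp
qed

end
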